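(* Let $n\ge 2$, $-\infty<\alpha<\beta$, $\beta\in(1/2,1]$, and let $f\in Q_\alpha^\beta(\mathbb{R}^n)$ with $\|f\|_{Q_\alpha^\beta(\mathbb{R}^n)}\ne 0$. Then there exist positive constants $B$ and $b$ such that the inequality $$(l(I))^{4\beta-4}\sum_{k=0}^{\infty}2^{(2(\alpha-\beta+1)-n)k}\sum_{J\in\mathcal{D}_k(I)}\frac{m_J(t)}{|J|}\le B\max\left\{1,\left(\frac{\|f\|_{Q_\alpha^\beta(\mathbb{R}^n)}}{t}\right)^{2}\right\}\exp\left(\frac{-bt}{\|f\|_{Q_\alpha^\beta(\mathbb{R}^n)}}\right)$$ holds for all $0<t\le\|f\|_{Q_\alpha^\beta(\mathbb{R}^n)}$ and all cubes $I\subset\mathbb{R}^n$, and also for all $t>\|f\|_{Q_\alpha^\beta(\mathbb{R}^n)}$ and all cubes $I\subset\mathbb{R}^n$ with $(l(I))^{2\beta-2}\ge 1$. Moreover, $$(l(I))^{4\beta-4}\sum_{k=0}^{\infty}2^{(2(\alpha-\beta+1)-n)k}\sum_{J\in\mathcal{D}_k(I)}\frac{m_J(t)}{|J|}\le B$$ holds for all $t>\|f\|_{Q_\alpha^\beta(\mathbb{R}^n)}$ and all cubes $I\subset\mathbb{R}^n$ with $(l(I))^{2\beta-2}<1$.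
   Context: All cubes in $\mathbb{R}^n$ have edges parallel to the coordinate axes; $l(I)$ denotes the edge length of a cube $I$ and $|E|$ the Lebesgue measure of a set $E$. For $\alpha\in(-\infty,\beta)$ and $\beta\in(1/2,1]$, $Q_\alpha^\beta(\mathbb{R}^n)$ is the set of all measurable complex-valued functions $f$ on $\mathbb{R}^n$ with $$\|f\|_{Q_\alpha^\beta(\mathbb{R}^n)}=\sup_I\left((l(I))^{2(\alpha+\beta-1)-n}\int_I\int_I\frac{|f(x)-f(y)|^2}{|x-y|^{n+2(\alpha-\beta+1)}}\,dx\,dy\right)^{1/2}<\infty,$$ the supremum being over all cubes $I$ in $\mathbb{R}^n$. For a cube $I$ and an integer $k\ge 0$, $\mathcal{D}_k(I)$ denotes the set of the $2^{kn}$ subcubes of $I$ of edge length $2^{-k}l(I)$ obtained by $k$ successive bipartitions of each edge of $I$. For a cube $J$, $f(J)=\frac{1}{|J|}\int_J f(x)\,dx$, and $m_J(t)=|\{x\in J:|f(x)-f(J)|>t\}|$ is the distribution function of $f-f(J)$ on $J$. *)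

theory Defs
  imports "HOL-Analysis.Analysis"
begin

text \<open>
  Cubes are closed, with edges parallel to the axes, and are given by their lower corner \<open>a\<close>
  and their edge length \<open>l > 0\<close>.  Including or excluding faces changes nothing below, since
  faces have Lebesgue measure zero.
\<close>

definition cube :: "real^'n \<Rightarrow> real \<Rightarrow> (real^'n) set" where
  "cube a l = cbox a (\<chi> i. a $ i + l)"

text \<open>
  Bisecting each edge \<open>k\<close> times cuts it into \<open>2 ^ k\<close> intervals of length \<open>l / 2 ^ k\<close>; the
  multi-index \<open>p\<close> selects one of these intervals for every coordinate.
\<close>

definition dyadic_subcubes :: "nat \<Rightarrow> real^'n \<Rightarrow> real \<Rightarrow> (real^'n) set set" where
  "dyadic_subcubes k a l =
     {cube (\<chi> i. a $ i + real (p i) * (l / 2 ^ k)) (l / 2 ^ k) | p :: 'n \<Rightarrow> nat. \<forall>i. p i < 2 ^ k}"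

definition ennreal_sqrt :: "ennreal \<Rightarrow> ennreal" where
  "ennreal_sqrt x = (if x = \<infinity> then \<infinity> else ennreal (sqrt (enn2real x)))"

text \<open>
  The extended-valued norm.  On the diagonal \<open>x = y\<close> the integrand is \<open>0\<close> (as \<open>0 / 0 = 0\<close>);
  the diagonal is a null set.
\<close>

definition Q_enorm :: "real \<Rightarrow> real \<Rightarrow> (real^'n \<Rightarrow> complex) \<Rightarrow> ennreal" where
  "Q_enorm \<alpha> \<beta> f =
     (SUP (a, l) \<in> {(a, l). 0 < l}.
        ennreal_sqrt
          (ennreal (l powr (2 * (\<alpha> + \<beta> - 1) - real CARD('n))) *
           (\<integral>\<^sup>+y\<in>cube a l. (\<integral>\<^sup>+x\<in>cube a l.
              ennreal ((cmod (f x - f y))\<^sup>2 /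
                       norm (x - y) powr (real CARD('n) + 2 * (\<alpha> - \<beta> + 1)))
            \<partial>lebesgue) \<partial>lebesgue)))"

definition Q_space :: "real \<Rightarrow> real \<Rightarrow> (real^'n \<Rightarrow> complex) set" where
  "Q_space \<alpha> \<beta> = {f. f \<in> borel_measurable lebesgue \<and> Q_enorm \<alpha> \<beta> f < \<infinity>}"

text \<open>The real-valued norm; meaningful for members of \<^const>\<open>Q_space\<close>.\<close>

definition Q_norm :: "real \<Rightarrow> real \<Rightarrow> (real^'n \<Rightarrow> complex) \<Rightarrow> real" where
  "Q_norm \<alpha> \<beta> f = enn2real (Q_enorm \<alpha> \<beta> f)"

definition average :: "(real^'n \<Rightarrow> complex) \<Rightarrow> (real^'n) set \<Rightarrow> complex" where
  "average f J = (LINT x:J|lebesgue. f x) /\<^sub>R measure lebesgue J"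

definition dist_fun :: "(real^'n \<Rightarrow> complex) \<Rightarrow> (real^'n) set \<Rightarrow> real \<Rightarrow> ennreal" where
  "dist_fun f J t = emeasure lebesgue {x \<in> J. cmod (f x - average f J) > t}"

text \<open>
  The weighted dyadic sum over the cube with corner \<open>a\<close> and edge length \<open>l\<close>.  It is taken in
  the extended nonnegative reals, so that a finite bound on it includes convergence of the series.
\<close>

definition dyadic_dist_sum ::
    "real \<Rightarrow> real \<Rightarrow> (real^'n \<Rightarrow> complex) \<Rightarrow> real^'n \<Rightarrow> real \<Rightarrow> real \<Rightarrow> ennreal" where
  "dyadic_dist_sum \<alpha> \<beta> f a l t =
     ennreal (l powr (4 * \<beta> - 4)) *
     (\<Sum>k. ennreal (2 powr ((2 * (\<alpha> - \<beta> + 1) - real CARD('n)) * real k)) *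
           (\<Sum>J\<in>dyadic_subcubes k a l. dist_fun f J t / emeasure lebesgue J))"

end

theory Submission
  imports Defs
begin

text \<open>
  Write \<open>D(J)\<close> for the integral of \<open>\<bar>f x - f y\<bar>\<^sup>2\<close> over \<open>J \<times> J\<close>.  Up to a factor 8, \<open>D(J)\<close> is controlled by
  the pairs whose distance is at least an eighth of the edge of \<open>J\<close>.  For such pairs in a cube of
  generation \<open>k\<close> the distance is comparable with the edge, so each pair counts for boundedly many \<open>k\<close>,
  and the weighted sum over all dyadic \<open>J\<close> of \<open>D(J) / \<bar>J\<bar>\<^sup>2\<close> is at most a constant times the square of the
  norm, for every real \<open>\<alpha>\<close>.  It remains to bound \<open>m\<^sub>J(t) / \<bar>J\<bar>\<close> by \<open>D(J) / \<bar>J\<bar>\<^sup>2\<close> times the right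
  function of \<open>t\<close>.  Chebyshev's inequality gives \<open>t\<^sup>-\<^sup>2\<close>.  If \<open>l(I) powr (2 * \<beta> - 2) \<ge> 1\<close>, the variances
  on all dyadic subcubes are bounded by a multiple of the squared norm, and a dyadic
  John-Nirenberg inequality gives exponential decay.  The latter is proved with a Bellman function
  that is linear in the variance near 0: averaging \<open>cosh - 1\<close> of the normalised
  deviation then retains the factor \<open>D(J) / \<bar>J\<bar>\<^sup>2\<close>, which makes the series over \<open>k\<close> converge.
\<close>

text \<open>
  As simplification rules these would turn \<^term>\<open>lebesgue\<close> into \<^term>\<open>lborel\<close>, where the facts about
  cubes below no longer match.
\<close>

declare emeasure_completion [simp del] measure_completion [simp del]

section \<open>Half-open cubes and their dyadic partitions\<close>

text \<open>Decay of \<open>m_J(t) / |J|\<close> by itself would not suffice. Generation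
  \<open>k\<close> has \<open>2^(n*k)\<close> cubes, so one bound for all ratios leaves the series
  of \<open>2 powr (2 * (\<alpha> - \<beta> + 1) * k)\<close>, which diverges once
  \<open>\<alpha> - \<beta> + 1 \<ge> 0\<close>. Every tail bound must stay proportional to the
  variance on \<open>J\<close>. Hence the interface \<open>dyadic_dist_sum_le\<close>: a factor
  \<open>\<kappa>\<close> such that the tails of the real and imaginary parts on each
  \<open>J\<close> are at most \<open>|J| * \<kappa> * variance\<close>. Chebyshev and
  John-Nirenberg are two choices of \<open>\<kappa>\<close>. The split by edge length comes from a
  single cube: the norm \<open>N\<close> bounds its variance only by
  \<open>C * N^2 * l powr (4 - 4 * \<beta>)\<close>. Otherwise this bound grows with
  \<open>l\<close>, and only Chebyshev is applied. The threshold \<open>t\<close> is halved twice: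
  between real and imaginary part, and between the jump of a dyadic mean and a remainder that is
  small in L1.\<close>

definition hcube :: "real^'n \<Rightarrow> real \<Rightarrow> (real^'n) set" where
  "hcube a l = {x. \<forall>i. a $ i \<le> x $ i \<and> x $ i < a $ i + l}"

definition grid :: "nat \<Rightarrow> ('n::finite \<Rightarrow> nat) set" where
  "grid k = {p. \<forall>i. p i < 2 ^ k}"

definition corner :: "real^'n \<Rightarrow> real \<Rightarrow> nat \<Rightarrow> ('n \<Rightarrow> nat) \<Rightarrow> real^'n" where
  "corner a l k p = (\<chi> i. a $ i + real (p i) * (l / 2 ^ k))"

lemma hcube_borel [measurable]: "hcube a l \<in> sets borel"
proof -
  have "hcube a l = (\<Inter>i. {x. a $ i \<le> x $ i} \<inter> {x. x $ i < a $ i + l})"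
    by (auto simp: hcube_def)
  moreover have "{x. a $ i \<le> x $ i} \<in> sets borel" "{x. x $ i < a $ i + l} \<in> sets borel" for i
    using closed_halfspace_component_ge_cart[of "a $ i" i] open_halfspace_component_lt_cart[of i "a $ i + l"]
    by auto
  ultimately show ?thesis by auto
qed

lemma hcube_lebesgue [measurable]: "hcube a l \<in> sets lebesgue"
  using hcube_borel by (metis lborelD sets_completionI_sets sets_lborel)

lemma cube_lebesgue [measurable]: "cube a l \<in> sets lebesgue"
  by (simp add: cube_def)

lemma hcube_subset_cube: "hcube a l \<subseteq> cube a l"
  by (auto simp: hcube_def cube_def mem_box_cart less_imp_le)

lemma cube_minus_hcube_null: "cube a l - hcube a l \<in> null_sets lebesgue"
proof -
  have "cube a l - hcube a l \<subseteq> cbox a (\<chi> i. a $ i + l) - box a (\<chi> i. a $ i + l)"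
    by (auto simp: hcube_def cube_def mem_box_cart less_imp_le)
  then have "negligible (cube a l - hcube a l)"
    using negligible_frontier_interval negligible_subset by blast
  then show ?thesis by (simp add: negligible_iff_null_sets)
qed

text \<open>The theorem speaks of closed cubes, whose dyadic subcubes share faces; half-open cubes
  partition exactly. This is the bridge by which measures and integrals pass from one kind to the
  other.\<close>

lemma AE_cube_hcube: "AE x in lebesgue. x \<in> cube a l \<longleftrightarrow> x \<in> hcube a l"
  using AE_not_in[OF cube_minus_hcube_null[of a l]] hcube_subset_cube[of a l] by auto

lemma emeasure_cube: "0 \<le> l \<Longrightarrow> emeasure lebesgue (cube (a::real^'n) l) = ennreal (l ^ CARD('n))"
proof -
  assume l: "0 \<le> l"
  then have ne: "cbox a (\<chi> i. a $ i + l) \<noteq> {}" by (auto simp: interval_ne_empty_cart)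
  have "emeasure lebesgue (cube a l) = ennreal (measure lborel (cbox a (\<chi> i. a $ i + l)))"
    unfolding cube_def using emeasure_lborel_cbox_finite[of a "\<chi> i. a $ i + l"] by (simp add: emeasure_completion measure_completion emeasure_eq_ennreal_measure less_top)
  also have "measure lborel (cbox a (\<chi> i. a $ i + l)) = l ^ CARD('n)"
    by (simp add: content_cbox_cart[OF ne])
  finally show ?thesis .
qed

lemma emeasure_hcube:
  assumes "0 \<le> l" shows "emeasure lebesgue (hcube (a::real^'n) l) = ennreal (l ^ CARD('n))"
proof -
  have "emeasure lebesgue (hcube a l) = emeasure lebesgue (cube a l)"
    by (rule emeasure_eq_AE) (use AE_cube_hcube[of a l] in auto)
  then show ?thesis using emeasure_cube[OF assms] by simp
qed

lemma measure_hcube: "0 \<le> l \<Longrightarrow> measure lebesgue (hcube (a::real^'n) l) = l ^ CARD('n)"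
  unfolding measure_def by (subst emeasure_hcube) auto

lemma measure_cube: "0 \<le> l \<Longrightarrow> measure lebesgue (cube (a::real^'n) l) = l ^ CARD('n)"
  unfolding measure_def by (subst emeasure_cube) auto

lemma grid_eq_PiE: "grid k = PiE UNIV (\<lambda>_. {..<2 ^ k})"
  by (auto simp: grid_def)

lemma finite_grid [simp]: "finite (grid k)"
  by (simp add: grid_eq_PiE finite_PiE)

lemma card_grid: "card (grid k :: ('n::finite \<Rightarrow> nat) set) = 2 ^ (k * CARD('n))"
  by (simp add: grid_eq_PiE card_PiE power_mult)

lemma hcube_grid_UN:
  assumes "0 < l"
  shows "hcube a l = (\<Union>p\<in>grid k. hcube (corner a l k p) (l / 2 ^ k))"
proof (intro set_eqI iffI)
  fix x assume x: "x \<in> hcube a l"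
  define h where "h = l / 2 ^ k"
  have h: "h > 0" "l = 2 ^ k * h" using assms by (auto simp: h_def)
  define p where "p i = nat \<lfloor>(x $ i - a $ i) / h\<rfloor>" for i
  have nn: "0 \<le> (x $ i - a $ i) / h" and lt: "(x $ i - a $ i) / h < 2 ^ k" for i
  proof -
    have "a $ i \<le> x $ i" "x $ i < a $ i + 2 ^ k * h" using x h(2) by (auto simp: hcube_def)
    then show "0 \<le> (x $ i - a $ i) / h" "(x $ i - a $ i) / h < 2 ^ k"
      using h(1) by (simp_all add: pos_divide_less_eq)
  qed
  have p: "real (p i) \<le> (x $ i - a $ i) / h" "(x $ i - a $ i) / h < real (p i) + 1" for i
    using nn[of i] unfolding p_def by linarith+
  have "real (p i) < 2 ^ k" for i using p(1)[of i] lt[of i] by linarith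
  then have "p i < 2 ^ k" for i by simp
  then have "p \<in> grid k" by (simp add: grid_def)
  moreover have "x \<in> hcube (corner a l k p) h"
    unfolding hcube_def corner_def h_def[symmetric]
  proof (intro CollectI allI conjI)
    fix i
    show "(\<chi> i. a $ i + real (p i) * h) $ i \<le> x $ i"
      using p(1)[of i] h(1) by (simp add: pos_le_divide_eq)
    show "x $ i < (\<chi> i. a $ i + real (p i) * h) $ i + h"
      using p(2)[of i] h(1) by (simp add: pos_divide_less_eq algebra_simps)
  qed
  ultimately show "x \<in> (\<Union>p\<in>grid k. hcube (corner a l k p) (l / 2 ^ k))"
    by (auto simp: h_def)
next
  fix x assume "x \<in> (\<Union>p\<in>grid k. hcube (corner a l k p) (l / 2 ^ k))"
  then obtain p where p: "p \<in> grid k" "x \<in> hcube (corner a l k p) (l / 2 ^ k)" by auto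
  define h where "h = l / 2 ^ k"
  have h: "h > 0" "l = 2 ^ k * h" using assms by (auto simp: h_def)
  show "x \<in> hcube a l"
    unfolding hcube_def
  proof (intro CollectI allI conjI)
    fix i
    have b: "a $ i + real (p i) * h \<le> x $ i" "x $ i < a $ i + real (p i) * h + h"
      using p(2) by (auto simp: hcube_def corner_def h_def)
    show "a $ i \<le> x $ i" using b(1) mult_nonneg_nonneg[of "real (p i)" h] h(1) by linarith
    have "p i + 1 \<le> 2 ^ k" using p(1) by (auto simp: grid_def Suc_le_eq)
    from of_nat_mono[OF this, where 'a=real] have "real (p i) + 1 \<le> 2 ^ k" by simp
    then have "(real (p i) + 1) * h \<le> 2 ^ k * h" using h(1) by (intro mult_right_mono) auto
    then show "x $ i < a $ i + l" using b(2) h(2) by (simp add: algebra_simps)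
  qed
qed

lemma disjoint_hcube_grid:
  assumes "0 < l"
  shows "disjoint_family_on (\<lambda>p. hcube (corner a l k p) (l / 2 ^ k)) (grid k)"
  unfolding disjoint_family_on_def
proof (intro ballI impI, rule ccontr)
  fix p q :: "'a \<Rightarrow> nat"
  assume "p \<noteq> q" and "hcube (corner a l k p) (l / 2 ^ k) \<inter> hcube (corner a l k q) (l / 2 ^ k) \<noteq> {}"
  then obtain x where x: "x \<in> hcube (corner a l k p) (l / 2 ^ k)" "x \<in> hcube (corner a l k q) (l / 2 ^ k)" by auto
  define h where "h = l / 2 ^ k"
  have h: "h > 0" using assms by (auto simp: h_def)
  have "p i = q i" for i
  proof -
    have "a $ i + real (p i) * h \<le> x $ i" "x $ i < a $ i + real (p i) * h + h"
      "a $ i + real (q i) * h \<le> x $ i" "x $ i < a $ i + real (q i) * h + h"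
      using x by (auto simp: hcube_def corner_def h_def)
    then have "real (p i) * h < (real (q i) + 1) * h" "real (q i) * h < (real (p i) + 1) * h"
      by (auto simp: algebra_simps)
    then show ?thesis using h by (simp add: mult_less_cancel_right)
  qed
  with \<open>p \<noteq> q\<close> show False by auto
qed

lemma dyadic_subcubes_eq: "dyadic_subcubes k a l = (\<lambda>p. cube (corner a l k p) (l / 2 ^ k)) ` grid k"
  by (auto simp: dyadic_subcubes_def grid_def corner_def)

text \<open>The left sum runs over a set of cubes, the right one over indices; a cube with several
  indices could only be counted more often on the right.\<close>

lemma sum_dyadic_subcubes_le:
  fixes F :: "(real^'n) set \<Rightarrow> ennreal"
  shows "(\<Sum>J\<in>dyadic_subcubes k a l. F J) \<le> (\<Sum>p\<in>grid k. F (cube (corner a l k p) (l / 2 ^ k)))"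
  unfolding dyadic_subcubes_eq
  by (rule order_trans[OF sum_image_le]) (auto simp: o_def)

definition child :: "('n \<Rightarrow> nat) \<Rightarrow> ('n \<Rightarrow> nat) \<Rightarrow> ('n \<Rightarrow> nat)" where
  "child p e = (\<lambda>i. 2 * p i + e i)"

lemma corner_child: "corner (corner a l k p) (l / 2 ^ k) 1 e = corner a l (Suc k) (child p e)"
  by (simp add: corner_def child_def vec_eq_iff field_simps)

lemma mem_grid_1: "e \<in> grid (Suc 0) \<longleftrightarrow> (\<forall>i. e i < 2)"
  by (simp add: grid_def)

lemma child_in_grid: "p \<in> grid k \<Longrightarrow> e \<in> grid 1 \<Longrightarrow> (\<lambda>i. 2 * p i + e i) \<in> grid (Suc k)"
  unfolding grid_def
proof (intro CollectI allI)
  fix i assume "p \<in> {p. \<forall>i. p i < 2 ^ k}" "e \<in> {p. \<forall>i. p i < 2 ^ 1}"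
  then have "p i < 2 ^ k" "e i < 2" by auto
  then show "2 * p i + e i < 2 ^ Suc k" by simp
qed

lemma div_in_grid: "q \<in> grid (Suc k) \<Longrightarrow> (\<lambda>i. q i div 2) \<in> grid k"
  by (auto simp: grid_def less_mult_imp_div_less mult.commute)

text \<open>Splitting off the last binary digit of each coordinate (\<open>div 2\<close>,
  \<open>mod 2\<close>) identifies generation \<open>k + 1\<close> with pairs of a cell and one of
  its children. This is what inductions over generations use.\<close>

lemma sum_grid_Suc:
  fixes F :: "('n::finite \<Rightarrow> nat) \<Rightarrow> real"
  shows "(\<Sum>q\<in>grid (Suc k). F q) = (\<Sum>p\<in>grid k. \<Sum>e\<in>grid 1. F (child p e))"
proof -
  have "(\<Sum>p\<in>grid k. \<Sum>e\<in>grid 1. F (child p e)) = (\<Sum>(p,e)\<in>grid k \<times> grid 1. F (child p e))"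
    by (simp add: sum.cartesian_product)
  also have "\<dots> = (\<Sum>q\<in>grid (Suc k). F q)"
  proof (rule sum.reindex_bij_witness[where i="\<lambda>q. (\<lambda>i. q i div 2, \<lambda>i. q i mod 2)" and j="\<lambda>(p,e). child p e"])
    fix z :: "('n \<Rightarrow> nat) \<times> ('n \<Rightarrow> nat)" assume "z \<in> grid k \<times> grid 1"
    then obtain p e where z: "z = (p, e)" "p \<in> grid k" "e \<in> grid (Suc 0)" by auto
    have "e i < 2" for i using z(3) by (simp add: mem_grid_1)
    then show "(\<lambda>i. (case z of (p, e) \<Rightarrow> child p e) i div 2, \<lambda>i. (case z of (p, e) \<Rightarrow> child p e) i mod 2) = z"
      by (simp add: z(1) child_def fun_eq_iff)
    show "(case z of (p, e) \<Rightarrow> child p e) \<in> grid (Suc k)"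
      using child_in_grid z by (simp add: child_def)
    show "F (case z of (p, e) \<Rightarrow> child p e) = (case z of (p, e) \<Rightarrow> F (child p e))"
      by (simp add: z(1))
  next
    fix q :: "'n \<Rightarrow> nat" assume q: "q \<in> grid (Suc k)"
    show "(case (\<lambda>i. q i div 2, \<lambda>i. q i mod 2) of (p, e) \<Rightarrow> child p e) = q"
      by (simp add: child_def)
    show "(\<lambda>i. q i div 2, \<lambda>i. q i mod 2) \<in> grid k \<times> grid 1"
      using div_in_grid[OF q] by (simp add: mem_grid_1)
  qed
  finally show ?thesis by simp
qed

section \<open>Double oscillation integrals\<close>

lemma sigma_finite_lebesgue: "sigma_finite_measure (lebesgue :: 'a::euclidean_space measure)"
proof -
  obtain A :: "'a set set" where "countable A" "A \<subseteq> sets lborel" "\<Union>A = space lborel" "\<forall>a\<in>A. emeasure lborel a \<noteq> \<infinity>"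
    using lborel.sigma_finite_countable by blast
  then have "countable A \<and> A \<subseteq> sets lebesgue \<and> \<Union>A = space lebesgue \<and> (\<forall>a\<in>A. emeasure lebesgue a \<noteq> \<infinity>)"
    by (auto simp: subset_iff emeasure_completion)
  then show ?thesis unfolding sigma_finite_measure_def by blast
qed

interpretation lebesgue: sigma_finite_measure "lebesgue :: 'a::euclidean_space measure"
  by (rule sigma_finite_lebesgue)

lemma measurable_id_lebesgue [measurable]: "(\<lambda>x. x) \<in> borel_measurable (lebesgue :: 'a::euclidean_space measure)"
  by (simp add: measurable_completion)

text \<open>The cut-off \<open>r = 0\<close> gives \<open>D(J)\<close>; \<open>r = l / 8\<close>
  gives its well-separated part. The general codomain serves both \<open>f\<close> itself and its
  real and imaginary parts.\<close>

definition double_osc :: "('a::euclidean_space \<Rightarrow> 'b::real_normed_vector) \<Rightarrow> 'a set \<Rightarrow> real \<Rightarrow> ennreal" where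
  "double_osc f S r = (\<integral>\<^sup>+y\<in>S. (\<integral>\<^sup>+x\<in>S. ennreal ((norm (f x - f y))\<^sup>2) * indicator {z. r \<le> norm (z - y)} x \<partial>lebesgue) \<partial>lebesgue)"

text \<open>The removed sets are sup-norm balls of radius \<open>l / 8\<close> about
  \<open>x\<close> and \<open>y\<close>. Each takes at most a quarter of the volume, as
  \<open>(1/4) ^ CARD('n) \<le> 1/4\<close>.\<close>

lemma emeasure_hcube_minus_balls:
  fixes a x y :: "real^'n"
  assumes "0 < l"
  shows "ennreal (l ^ CARD('n) / 2) \<le> emeasure lebesgue (hcube a l - cube (x - (\<chi> i. l / 8)) (l / 4) - cube (y - (\<chi> i. l / 8)) (l / 4))"
    (is "_ \<le> emeasure lebesgue ?Z")
proof -
  let ?X = "cube (x - (\<chi> i. l / 8)) (l / 4)" and ?Y = "cube (y - (\<chi> i. l / 8)) (l / 4)"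
  have fin: "emeasure lebesgue ?Z < \<infinity>"
    using emeasure_mono[of ?Z "hcube a l" lebesgue] assms
    by (auto simp: emeasure_hcube intro: le_less_trans[OF _ ennreal_less_top])
  have "ennreal (l ^ CARD('n)) = emeasure lebesgue (hcube a l)" using assms by (simp add: emeasure_hcube)
  also have "\<dots> \<le> emeasure lebesgue (?Z \<union> (?X \<union> ?Y))" by (intro emeasure_mono) auto
  also have "\<dots> \<le> emeasure lebesgue ?Z + emeasure lebesgue (?X \<union> ?Y)" by (intro emeasure_subadditive) auto
  also have "\<dots> \<le> emeasure lebesgue ?Z + (emeasure lebesgue ?X + emeasure lebesgue ?Y)"
    by (intro add_left_mono emeasure_subadditive) auto
  also have "\<dots> = ennreal (measure lebesgue ?Z) + (ennreal ((l / 4) ^ CARD('n)) + ennreal ((l / 4) ^ CARD('n)))"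
    using assms fin by (simp add: emeasure_cube measure_cube emeasure_eq_ennreal_measure)
  also have "\<dots> = ennreal (measure lebesgue ?Z + 2 * (l / 4) ^ CARD('n))"
    using assms by (simp flip: ennreal_plus)
  finally have *: "l ^ CARD('n) \<le> measure lebesgue ?Z + 2 * (l / 4) ^ CARD('n)"
    using assms by (subst (asm) ennreal_le_iff) (auto intro!: add_nonneg_nonneg)
  have "(1/4::real) ^ CARD('n) \<le> (1/4) ^ 1" by (intro power_decreasing) auto
  then have "(l / 4) ^ CARD('n) \<le> l ^ CARD('n) / 4"
    using assms mult_left_mono[of "(1/4::real) ^ CARD('n)" "1/4" "l ^ CARD('n)"] by (simp add: power_divide)
  with * have "l ^ CARD('n) / 2 \<le> measure lebesgue ?Z" by simp
  then have "ennreal (l ^ CARD('n) / 2) \<le> ennreal (measure lebesgue ?Z)" by (rule ennreal_leI)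
  also have "\<dots> = emeasure lebesgue ?Z" using fin by (simp add: emeasure_eq_ennreal_measure)
  finally show ?thesis .
qed

lemma near_in_cube:
  fixes x z :: "real^'n"
  assumes "z \<notin> cube (x - (\<chi> i. l / 8)) (l / 4)"
  shows "l / 8 \<le> norm (z - x)"
proof (rule ccontr)
  assume "\<not> l / 8 \<le> norm (z - x)"
  then have small: "\<bar>z $ i - x $ i\<bar> < l / 8" for i
    using component_le_norm_cart[of "z - x" i] by simp
  have "z \<in> cube (x - (\<chi> i. l / 8)) (l / 4)"
    unfolding cube_def mem_box_cart
  proof (intro allI conjI)
    fix i
    have "- (l / 8) < z $ i - x $ i" "z $ i - x $ i < l / 8"
      using small[of i] by linarith+
    then show "(x - (\<chi> i. l / 8)) $ i \<le> z $ i" "z $ i \<le> (\<chi> j. (x - (\<chi> i. l / 8)) $ j + l / 4) $ i"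
      by simp_all
  qed
  with assms show False by simp
qed

text \<open>
  Every pair \<open>x, y\<close> is compared with the points \<open>z\<close> of the cube far from both, which fill at least
  half of it.
\<close>
lemma double_osc_le_far:
  fixes f :: "real^'n \<Rightarrow> 'b::{real_normed_vector, second_countable_topology}"
  assumes f [measurable]: "f \<in> borel_measurable lebesgue" and l: "0 < l"
  shows "double_osc f (hcube a l) 0 \<le> 8 * double_osc f (hcube a l) (l / 8)"
proof -
  let ?S = "hcube a l" and ?L = "l ^ CARD('n)"
  let ?F = "\<lambda>x y. ennreal ((norm (f x - f y))\<^sup>2) * indicator {z. l / 8 \<le> norm (z - y)} x * indicator ?S x"
  let ?A = "\<lambda>y. \<integral>\<^sup>+x. ?F x y \<partial>lebesgue"
  have far [measurable]: "Measurable.pred (lebesgue \<Otimes>\<^sub>M lebesgue) (\<lambda>p. l / 8 \<le> norm (snd p - fst p :: real^'n))"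
    by measurable
  have meas: "(\<lambda>(y, x). ?F x y) \<in> borel_measurable (lebesgue \<Otimes>\<^sub>M lebesgue)"
    unfolding indicator_def by measurable
  have A [measurable]: "?A \<in> borel_measurable lebesgue"
    using lebesgue.borel_measurable_nn_integral[OF meas] by simp
  have Fm: "(\<lambda>x. ?F x y) \<in> borel_measurable lebesgue" for y
    unfolding indicator_def by measurable
  \<comment> \<open>\<open>?c\<close> is integrated over \<open>z\<close> in \<open>?Z\<close>,
    where the difference is split through \<open>f z\<close> and both resulting pairs are far
    apart.\<close>
  have pt: "ennreal (?L / 2) * ennreal ((norm (f x - f y))\<^sup>2) \<le> 2 * ?A x + 2 * ?A y" for x y
  proof -
    let ?Z = "?S - cube (x - (\<chi> i. l / 8)) (l / 4) - cube (y - (\<chi> i. l / 8)) (l / 4)"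
    let ?c = "ennreal ((norm (f x - f y))\<^sup>2)"
    have "ennreal (?L / 2) * ?c \<le> emeasure lebesgue ?Z * ?c"
      by (intro mult_right_mono emeasure_hcube_minus_balls l) auto
    also have "\<dots> = (\<integral>\<^sup>+z. ?c * indicator ?Z z \<partial>lebesgue)"
      by (subst nn_integral_cmult_indicator) (auto simp: mult.commute)
    also have "\<dots> \<le> (\<integral>\<^sup>+z. 2 * ?F z x + 2 * ?F z y \<partial>lebesgue)"
    proof (rule nn_integral_mono)
      fix z :: "real^'n"
      show "?c * indicator ?Z z \<le> 2 * ?F z x + 2 * ?F z y"
      proof (cases "z \<in> ?Z")
        case True
        then have far: "l / 8 \<le> norm (z - x)" "l / 8 \<le> norm (z - y)" "z \<in> ?S"
          using near_in_cube by auto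
        have "norm (f x - f y) \<le> norm (f z - f x) + norm (f z - f y)"
          using norm_triangle_ineq4[of "f z - f y" "f z - f x"] by simp
        then have "(norm (f x - f y))\<^sup>2 \<le> (norm (f z - f x) + norm (f z - f y))\<^sup>2"
          by (intro power_mono) auto
        also have "\<dots> \<le> 2 * (norm (f z - f x))\<^sup>2 + 2 * (norm (f z - f y))\<^sup>2"
          using zero_le_power2[of "norm (f z - f x) - norm (f z - f y)"] by (simp add: power2_eq_square algebra_simps)
        finally have "?c \<le> ennreal (2 * (norm (f z - f x))\<^sup>2 + 2 * (norm (f z - f y))\<^sup>2)"
          by (rule ennreal_leI)
        then show ?thesis using True far by (simp add: ennreal_mult)
      qed simp
    qed
    also have "\<dots> = 2 * ?A x + 2 * ?A y"
      using Fm by (simp add: nn_integral_add nn_integral_cmult)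
    finally show ?thesis .
  qed
  have D: "(\<integral>\<^sup>+y\<in>?S. ?A y \<partial>lebesgue) = double_osc f ?S (l / 8)"
    by (simp add: double_osc_def mult_ac)
  have S: "emeasure lebesgue ?S = ennreal ?L" using l by (simp add: emeasure_hcube)
  have cst: "(\<integral>\<^sup>+x\<in>?S. c \<partial>lebesgue) = c * ennreal ?L" for c
    by (subst nn_integral_cmult_indicator) (auto simp: S)
  \<comment> \<open>Integrating \<open>pt\<close> in both variables bounds \<open>L / 2\<close>
    times the full integral by \<open>4 * L\<close> times the far one: this is the constant
    8.\<close>
  have "ennreal (?L / 2) * double_osc f ?S 0 = (\<integral>\<^sup>+y\<in>?S. (\<integral>\<^sup>+x\<in>?S. ennreal (?L / 2) * ennreal ((norm (f x - f y))\<^sup>2) \<partial>lebesgue) \<partial>lebesgue)"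
  proof -
    have [measurable]: "(\<lambda>y. \<integral>\<^sup>+x. ennreal ((norm (f x - f y))\<^sup>2) * indicator ?S x \<partial>lebesgue) \<in> borel_measurable lebesgue"
      using lebesgue.borel_measurable_nn_integral[of "\<lambda>y x. ennreal ((norm (f x - f y))\<^sup>2) * indicator ?S x" lebesgue]
      by simp
    show ?thesis
      by (simp add: double_osc_def nn_integral_cmult mult.assoc)
  qed
  also have "\<dots> \<le> (\<integral>\<^sup>+y\<in>?S. (\<integral>\<^sup>+x\<in>?S. 2 * ?A x + 2 * ?A y \<partial>lebesgue) \<partial>lebesgue)"
    by (intro nn_integral_mono mult_right_mono pt) auto
  also have "\<dots> = (\<integral>\<^sup>+y\<in>?S. 2 * double_osc f ?S (l / 8) + 2 * ?A y * ennreal ?L \<partial>lebesgue)"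
    by (intro set_nn_integral_cong refl, subst nn_set_integral_add)
      (auto simp: cst D[symmetric] nn_integral_cmult mult.assoc)
  also have "\<dots> = 2 * double_osc f ?S (l / 8) * ennreal ?L + 2 * double_osc f ?S (l / 8) * ennreal ?L"
  proof -
    have "(\<integral>\<^sup>+y\<in>?S. 2 * ?A y * ennreal ?L \<partial>lebesgue) = (\<integral>\<^sup>+y. 2 * ennreal ?L * (?A y * indicator ?S y) \<partial>lebesgue)"
      by (intro nn_integral_cong) (simp add: mult_ac)
    also have "\<dots> = 2 * ennreal ?L * double_osc f ?S (l / 8)"
      unfolding D[symmetric] by (rule nn_integral_cmult) simp
    finally have e: "(\<integral>\<^sup>+y\<in>?S. 2 * ?A y * ennreal ?L \<partial>lebesgue) = 2 * ennreal ?L * double_osc f ?S (l / 8)" .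
    have "(\<integral>\<^sup>+y\<in>?S. 2 * double_osc f ?S (l / 8) + 2 * ?A y * ennreal ?L \<partial>lebesgue)
      = (\<integral>\<^sup>+y\<in>?S. 2 * double_osc f ?S (l / 8) \<partial>lebesgue) + (\<integral>\<^sup>+y\<in>?S. 2 * ?A y * ennreal ?L \<partial>lebesgue)"
      by (rule nn_set_integral_add) auto
    then show ?thesis unfolding cst e by (simp only: mult_ac)
  qed
  also have "\<dots> = ennreal (?L / 2) * (8 * double_osc f ?S (l / 8))"
  proof -
    have "ennreal ?L = 2 * ennreal (?L / 2)" using l by (simp flip: ennreal_numeral ennreal_mult)
    then have "2 * d * ennreal ?L + 2 * d * ennreal ?L = (4 + 4) * (ennreal (?L / 2) * d)" for d
      unfolding distrib_right by (simp add: mult_ac)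
    from this[of "double_osc f ?S (l / 8)"] show ?thesis by (simp add: mult_ac)
  qed
  finally show ?thesis
    using l by (subst (asm) ennreal_mult_le_mult_iff) auto
qed

lemma set_sum_UN_disjoint:
  fixes F :: "'a::euclidean_space \<Rightarrow> ennreal"
  assumes "finite I" "disjoint_family_on A I" "\<And>i. i \<in> I \<Longrightarrow> A i \<in> sets lebesgue" "F \<in> borel_measurable lebesgue"
  shows "(\<Sum>i\<in>I. \<integral>\<^sup>+x\<in>A i. F x \<partial>lebesgue) = (\<integral>\<^sup>+x\<in>(\<Union>i\<in>I. A i). F x \<partial>lebesgue)"
proof -
  have "(\<Sum>i\<in>I. \<integral>\<^sup>+x\<in>A i. F x \<partial>lebesgue) = (\<integral>\<^sup>+x. (\<Sum>i\<in>I. F x * indicator (A i) x) \<partial>lebesgue)"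
    using assms by (subst nn_integral_sum) auto
  moreover have "(\<Sum>i\<in>I. F x * indicator (A i) x) = F x * indicator (\<Union>i\<in>I. A i) x" for x
    using assms(1,2) by (simp add: indicator_UN_disjoint sum_distrib_left)
  ultimately show ?thesis by simp
qed

section \<open>Summation over dyadic scales\<close>

lemma norm_diff_hcube:
  fixes x y :: "real^'n"
  assumes "x \<in> hcube a l" "y \<in> hcube a l"
  shows "norm (x - y) \<le> real CARD('n) * l"
proof -
  have "norm (x - y) \<le> (\<Sum>i\<in>UNIV. \<bar>(x - y) $ i\<bar>)" by (rule norm_le_l1_cart)
  also have "\<dots> \<le> (\<Sum>i\<in>(UNIV::'n set). l)"
  proof (rule sum_mono)
    fix i
    have "a $ i \<le> x $ i" "x $ i < a $ i + l" "a $ i \<le> y $ i" "y $ i < a $ i + l"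
      using assms by (auto simp: hcube_def)
    then show "\<bar>(x - y) $ i\<bar> \<le> l" by simp
  qed
  finally show ?thesis by simp
qed

text \<open>Since \<open>\<alpha>\<close> may be any real below \<open>\<beta>\<close>, the kernel
  exponent can have either sign; the absolute value treats both at once.\<close>

lemma powr_ratio_bound:
  fixes r c \<theta> :: real
  assumes "1 \<le> c" "1 / c \<le> r" "r \<le> c"
  shows "r powr \<theta> \<le> c powr \<bar>\<theta>\<bar>"
proof -
  have r: "0 < r" using assms by (smt (verit) divide_pos_pos)
  have "\<bar>ln r\<bar> \<le> ln c"
  proof -
    have "ln (1 / c) \<le> ln r" using assms r by (intro ln_mono) auto
    moreover have "ln r \<le> ln c" using assms r by (intro ln_mono) auto
    ultimately show ?thesis using assms by (simp add: ln_div)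
  qed
  then have "\<theta> * ln r \<le> \<bar>\<theta>\<bar> * ln c"
    using abs_ge_self[of "\<theta> * ln r"] mult_left_mono[of "\<bar>ln r\<bar>" "ln c" "\<bar>\<theta>\<bar>"] by (simp add: abs_mult)
  then show ?thesis using assms r by (simp add: powr_def)
qed

text \<open>A pair at distance \<open>d\<close> is relevant to few generations: if \<open>j\<close>
  is the first and \<open>j + i\<close> another, then \<open>2 ^ i \<le> 8 * m\<close>, and the
  crude \<open>i < 2 ^ i\<close> bounds \<open>i\<close>.\<close>

lemma card_dyadic_scales:
  fixes d l c :: real and m :: nat
  assumes "0 < l" "1 \<le> m"
  shows "finite {k. l / 2 ^ k / 8 \<le> d \<and> d \<le> real m * (l / 2 ^ k)}"
    and "card {k. l / 2 ^ k / 8 \<le> d \<and> d \<le> real m * (l / 2 ^ k)} \<le> 8 * m + 1"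
proof -
  let ?K = "{k. l / 2 ^ k / 8 \<le> d \<and> d \<le> real m * (l / 2 ^ k)}"
  have sub: "?K \<subseteq> {j..j + 8 * m}" if j: "j \<in> ?K" "\<forall>k\<in>?K. j \<le> k" for j
  proof
    fix k assume k: "k \<in> ?K"
    then have "j \<le> k" using j by blast
    then obtain i where i: "k = j + i" using le_Suc_ex by blast
    have "l / 2 ^ j / 8 \<le> real m * (l / 2 ^ k)" using j k by (auto intro: order_trans)
    then have "l * 2 ^ i \<le> l * (8 * real m)"
      using assms by (simp add: i power_add field_simps)
    then have "2 ^ i \<le> 8 * real m" using assms(1) by (simp only: mult_le_cancel_left_pos)
    with of_nat_less_two_power[of i, where 'a=real] have "real i < 8 * real m" by linarith
    then have "i \<le> 8 * m" by linarith
    then show "k \<in> {j..j + 8 * m}" using i by simp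
  qed
  have "finite ?K \<and> card ?K \<le> 8 * m + 1"
  proof (cases "?K = {}")
    case True
    then show ?thesis by (metis card.empty finite.emptyI zero_le)
  next
    case False
    then have "(LEAST k. k \<in> ?K) \<in> ?K" "\<forall>k\<in>?K. (LEAST k. k \<in> ?K) \<le> k"
      by (metis (mono_tags, lifting) LeastI_ex ex_in_conv) (simp add: Least_le)
    from sub[OF this] have *: "?K \<subseteq> {(LEAST k. k \<in> ?K)..(LEAST k. k \<in> ?K) + 8 * m}" .
    from card_mono[OF _ *] finite_subset[OF *] show ?thesis by simp
  qed
  then show "finite ?K" "card ?K \<le> 8 * m + 1" by auto
qed

text \<open>A far pair in a cube of edge \<open>h\<close> has distance between \<open>h / 8\<close>
  and \<open>n * h\<close>, so its kernel is comparable with \<open>h powr (- \<theta>)\<close>.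
  After summation each pair is weighted by the number of generations with such an
  \<open>h\<close>.\<close>

lemma sum_double_osc_le:
  fixes f :: "real^'n \<Rightarrow> 'b::{real_normed_vector, second_countable_topology}" and \<theta> l :: real
  defines "n \<equiv> real CARD('n)"
  defines "kern \<equiv> \<lambda>x y. ennreal ((norm (f x - f y))\<^sup>2 / norm (x - y) powr \<theta>)"
  assumes f [measurable]: "f \<in> borel_measurable lebesgue" and l: "0 < l"
  shows "(\<Sum>k. ennreal (2 powr ((\<theta> - 2 * n) * real k)) *
      (\<Sum>p\<in>grid k. double_osc f (hcube (corner a l k p) (l / 2 ^ k)) 0 / ennreal (((l / 2 ^ k) ^ CARD('n))\<^sup>2)))
    \<le> ennreal (8 * (8 * n) powr \<bar>\<theta>\<bar> * (8 * n + 1)) *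
      (ennreal (l powr (\<theta> - 2 * n)) * (\<integral>\<^sup>+y\<in>hcube a l. (\<integral>\<^sup>+x\<in>hcube a l. kern x y \<partial>lebesgue) \<partial>lebesgue))"
proof -
  let ?I = "hcube a l"
  let ?J = "\<lambda>k p. hcube (corner a l k p) (l / 2 ^ k)"
  let ?C = "8 * (8 * n) powr \<bar>\<theta>\<bar>"
  have n1: "1 \<le> n" unfolding n_def by (simp add: Suc_leI)
  \<comment> \<open>Lying in a common cell of generation \<open>k\<close> is relaxed to a condition
    on the distance alone, which no longer mentions the cell.\<close>
  define sc where "sc k = (\<lambda>x y::real^'n. indicator {d. l / 2 ^ k / 8 \<le> d \<and> d \<le> n * (l / 2 ^ k)} (norm (x - y)) :: ennreal)" for k
  have sc_meas [measurable]: "(\<lambda>(y, x). sc k x y) \<in> borel_measurable (lebesgue \<Otimes>\<^sub>M lebesgue)" for k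
    unfolding sc_def by measurable
  have kern_meas [measurable]: "(\<lambda>(y, x). kern x y) \<in> borel_measurable (lebesgue \<Otimes>\<^sub>M lebesgue)"
    unfolding kern_def by measurable
  have inner_meas [measurable]: "(\<lambda>y. \<integral>\<^sup>+x\<in>S. kern x y * sc k x y \<partial>lebesgue) \<in> borel_measurable lebesgue"
    if "S \<in> sets lebesgue" for k S
    using lebesgue.borel_measurable_nn_integral[of "\<lambda>y x. kern x y * sc k x y * indicator S x" lebesgue] that
    by simp
  define T where "T k = (\<integral>\<^sup>+y\<in>?I. (\<integral>\<^sup>+x\<in>?I. kern x y * sc k x y \<partial>lebesgue) \<partial>lebesgue)" for k
  \<comment> \<open>The inner variable is released from the cell to all of \<open>?I\<close>. The
    cells then partition the range of the outer variable only, and their sum is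
    \<open>T k\<close>.\<close>
  have J: "double_osc f (?J k p) 0 \<le> ennreal (?C * (l / 2 ^ k) powr \<theta>) *
      (\<integral>\<^sup>+y\<in>?J k p. (\<integral>\<^sup>+x\<in>?I. kern x y * sc k x y \<partial>lebesgue) \<partial>lebesgue)" if p: "p \<in> grid k" for k p
  proof -
    define h where "h = l / 2 ^ k"
    have h: "0 < h" using l by (simp add: h_def)
    let ?c = "ennreal ((8 * n) powr \<bar>\<theta>\<bar> * h powr \<theta>)"
    have JI: "?J k p \<subseteq> ?I" using hcube_grid_UN[OF l, of a k] p by auto
    have pt: "ennreal ((norm (f x - f y))\<^sup>2) * indicator {z. h / 8 \<le> norm (z - y)} x \<le> ?c * (kern x y * sc k x y)"
      if "x \<in> ?J k p" "y \<in> ?J k p" for x y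
    proof (cases "h / 8 \<le> norm (x - y)")
      case True
      let ?d = "norm (x - y)"
      have d: "?d \<le> n * h" "0 < ?d" using norm_diff_hcube[OF that] True h by (auto simp: n_def h_def)
      have s: "sc k x y = 1" using True d by (simp add: sc_def h_def)
      have "(?d / h) powr \<theta> \<le> (8 * n) powr \<bar>\<theta>\<bar>"
      proof (rule powr_ratio_bound)
        have "8 * ?d * 1 \<le> 8 * ?d * n" using n1 d by (intro mult_left_mono) auto
        moreover have "h \<le> 8 * ?d" using True by simp
        ultimately have "h \<le> 8 * ?d * n" by simp
        then have "h \<le> 8 * n * ?d" by (simp only: mult_ac)
        then show "1 / (8 * n) \<le> ?d / h" using h n1 by (simp add: field_simps)
        have "0 \<le> n * h" using h n1 by (intro mult_nonneg_nonneg) auto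
        then have "?d \<le> 8 * (n * h)" using d by linarith
        then show "?d / h \<le> 8 * n" unfolding pos_divide_le_eq[OF h] by (simp only: mult.assoc)
      qed (use n1 in auto)
      then have "?d powr \<theta> \<le> (8 * n) powr \<bar>\<theta>\<bar> * h powr \<theta>"
        using h d by (simp add: powr_divide pos_divide_le_eq)
      then have "(norm (f x - f y))\<^sup>2 / ?d powr \<theta> * ?d powr \<theta> \<le> (norm (f x - f y))\<^sup>2 / ?d powr \<theta> * ((8 * n) powr \<bar>\<theta>\<bar> * h powr \<theta>)"
        by (intro mult_left_mono) auto
      then have "(norm (f x - f y))\<^sup>2 \<le> ((8 * n) powr \<bar>\<theta>\<bar> * h powr \<theta>) * ((norm (f x - f y))\<^sup>2 / ?d powr \<theta>)"
        using d by (simp add: mult.commute)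
      then have "ennreal ((norm (f x - f y))\<^sup>2) \<le> ennreal (((8 * n) powr \<bar>\<theta>\<bar> * h powr \<theta>) * ((norm (f x - f y))\<^sup>2 / ?d powr \<theta>))"
        by (rule ennreal_leI)
      also have "\<dots> = ?c * kern x y" unfolding kern_def by (rule ennreal_mult) auto
      finally show ?thesis using True s by simp
    qed simp
    have "double_osc f (?J k p) 0 \<le> 8 * double_osc f (?J k p) (h / 8)"
      using double_osc_le_far[OF f h] by (simp add: h_def)
    also have "double_osc f (?J k p) (h / 8) \<le> (\<integral>\<^sup>+y\<in>?J k p. (\<integral>\<^sup>+x\<in>?I. ?c * (kern x y * sc k x y) \<partial>lebesgue) \<partial>lebesgue)"
      unfolding double_osc_def
    proof (intro nn_integral_mono)
      fix y :: "real^'n"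
      show "(\<integral>\<^sup>+x\<in>?J k p. ennreal ((norm (f x - f y))\<^sup>2) * indicator {z. h / 8 \<le> norm (z - y)} x \<partial>lebesgue) * indicator (?J k p) y
        \<le> (\<integral>\<^sup>+x\<in>?I. ?c * (kern x y * sc k x y) \<partial>lebesgue) * indicator (?J k p) y"
      proof (cases "y \<in> ?J k p")
        case True
        have "ennreal ((norm (f x - f y))\<^sup>2) * indicator {z. h / 8 \<le> norm (z - y)} x * indicator (?J k p) x
          \<le> ?c * (kern x y * sc k x y) * indicator ?I x" for x
          using pt[of x y] True JI by (cases "x \<in> ?J k p") auto
        then show ?thesis by (intro mult_right_mono nn_integral_mono) auto
      qed simp
    qed
    also have "\<dots> = ?c * (\<integral>\<^sup>+y\<in>?J k p. (\<integral>\<^sup>+x\<in>?I. kern x y * sc k x y \<partial>lebesgue) \<partial>lebesgue)"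
    proof -
      have "(\<lambda>x. kern x y * sc k x y) \<in> borel_measurable lebesgue" for y
        unfolding kern_def sc_def by measurable
      then show ?thesis
        using inner_meas[of ?I k] by (simp add: nn_integral_cmult mult.assoc)
    qed
    finally show ?thesis
      unfolding h_def by (simp add: ennreal_mult mult.assoc mult_left_mono)
  qed
  \<comment> \<open>The weight of generation \<open>k\<close> is exactly the one that makes the
    factors \<open>2 ^ k\<close> cancel, so every \<open>T k\<close> gets the same
    coefficient.\<close>
  have weight: "2 powr ((\<theta> - 2 * n) * real k) * ((l / 2 ^ k) powr \<theta> / ((l / 2 ^ k) ^ CARD('n))\<^sup>2) = l powr (\<theta> - 2 * n)" for k
  proof -
    have "((l / 2 ^ k) ^ CARD('n))\<^sup>2 = (l / 2 ^ k) powr (2 * n)"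
      using l by (simp add: n_def powr_realpow[symmetric] powr_powr power_mult[symmetric] mult.commute flip: of_nat_mult)
    then have "(l / 2 ^ k) powr \<theta> / ((l / 2 ^ k) ^ CARD('n))\<^sup>2 = (l / 2 ^ k) powr (\<theta> - 2 * n)"
      by (simp add: powr_diff)
    also have "\<dots> = l powr (\<theta> - 2 * n) / 2 powr ((\<theta> - 2 * n) * real k)"
      using l by (simp add: powr_divide powr_realpow[symmetric] powr_powr mult.commute)
    finally show ?thesis by simp
  qed
  have summand: "ennreal (2 powr ((\<theta> - 2 * n) * real k)) *
      (\<Sum>p\<in>grid k. double_osc f (?J k p) 0 / ennreal (((l / 2 ^ k) ^ CARD('n))\<^sup>2))
    \<le> ennreal (?C * l powr (\<theta> - 2 * n)) * T k" for k
  proof -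
    let ?w = "2 powr ((\<theta> - 2 * n) * real k)" and ?q = "((l / 2 ^ k) ^ CARD('n))\<^sup>2"
    have q: "0 < ?q" using l by simp
    have "(\<Sum>p\<in>grid k. double_osc f (?J k p) 0) \<le> (\<Sum>p\<in>grid k. ennreal (?C * (l / 2 ^ k) powr \<theta>) *
      (\<integral>\<^sup>+y\<in>?J k p. (\<integral>\<^sup>+x\<in>?I. kern x y * sc k x y \<partial>lebesgue) \<partial>lebesgue))"
      by (intro sum_mono J)
    also have "\<dots> = ennreal (?C * (l / 2 ^ k) powr \<theta>) * T k"
      unfolding T_def sum_distrib_left[symmetric]
      by (subst set_sum_UN_disjoint) (auto simp: disjoint_hcube_grid[OF l] hcube_grid_UN[OF l, of a k, symmetric])
    finally have "ennreal ?w * ((\<Sum>p\<in>grid k. double_osc f (?J k p) 0) / ennreal ?q) \<le> ennreal ?w * (ennreal (?C * (l / 2 ^ k) powr \<theta>) * T k / ennreal ?q)"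
      by (intro mult_left_mono divide_right_mono_ennreal) auto
    also have "\<dots> = ennreal (?w * ((?C * (l / 2 ^ k) powr \<theta>) / ?q)) * T k"
      using q n1 by (simp add: ennreal_mult divide_ennreal[symmetric] ennreal_divide_times mult_ac divide_ennreal_def)
    also have "?w * ((?C * (l / 2 ^ k) powr \<theta>) / ?q) = ?C * l powr (\<theta> - 2 * n)"
      using weight[of k] by (simp add: mult.assoc mult.left_commute[of ?w] times_divide_eq_right[symmetric] del: times_divide_eq_right)
    finally show ?thesis
      by (simp add: sum_divide_distrib divide_ennreal_def sum_distrib_right)
  qed
  have "(\<Sum>k. T k) = (\<integral>\<^sup>+y\<in>?I. (\<integral>\<^sup>+x\<in>?I. kern x y * (\<Sum>k. sc k x y) \<partial>lebesgue) \<partial>lebesgue)"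
  proof -
    have m: "(\<lambda>x. kern x y * sc k x y) \<in> borel_measurable lebesgue" for k y
      unfolding kern_def sc_def by measurable
    have "(\<Sum>k. T k) = (\<integral>\<^sup>+y. (\<Sum>k. (\<integral>\<^sup>+x\<in>?I. kern x y * sc k x y \<partial>lebesgue) * indicator ?I y) \<partial>lebesgue)"
      unfolding T_def by (subst nn_integral_suminf) auto
    also have "\<dots> = (\<integral>\<^sup>+y\<in>?I. (\<Sum>k. \<integral>\<^sup>+x\<in>?I. kern x y * sc k x y \<partial>lebesgue) \<partial>lebesgue)"
      by simp
    also have "\<dots> = (\<integral>\<^sup>+y\<in>?I. (\<integral>\<^sup>+x. (\<Sum>k. kern x y * sc k x y * indicator ?I x) \<partial>lebesgue) \<partial>lebesgue)"
      using m by (subst nn_integral_suminf) auto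
    also have "\<dots> = (\<integral>\<^sup>+y\<in>?I. (\<integral>\<^sup>+x\<in>?I. kern x y * (\<Sum>k. sc k x y) \<partial>lebesgue) \<partial>lebesgue)"
      by simp
    finally show ?thesis .
  qed
  also have "\<dots> \<le> (\<integral>\<^sup>+y\<in>?I. (\<integral>\<^sup>+x\<in>?I. ennreal (8 * n + 1) * kern x y \<partial>lebesgue) \<partial>lebesgue)"
  proof -
    have "(\<Sum>k. sc k x y) \<le> ennreal (8 * n + 1)" for x y
    proof -
      note K = card_dyadic_scales[OF l, of "CARD('n)" "norm (x - y)", folded n_def]
      have "(\<Sum>k. sc k x y) = (\<Sum>k\<in>{k. l / 2 ^ k / 8 \<le> norm (x - y) \<and> norm (x - y) \<le> n * (l / 2 ^ k)}. sc k x y)"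
        by (rule suminf_finite) (use K in \<open>auto simp: sc_def Suc_leI\<close>)
      also have "\<dots> = (\<Sum>k\<in>{k. l / 2 ^ k / 8 \<le> norm (x - y) \<and> norm (x - y) \<le> n * (l / 2 ^ k)}. 1)"
        by (intro sum.cong) (auto simp: sc_def)
      also have "\<dots> = of_nat (card {k. l / 2 ^ k / 8 \<le> norm (x - y) \<and> norm (x - y) \<le> n * (l / 2 ^ k)})"
        by simp
      also have "\<dots> \<le> of_nat (8 * CARD('n) + 1)" by (rule of_nat_mono) (use K in \<open>simp add: Suc_leI\<close>)
      also have "\<dots> = ennreal (8 * n + 1)" unfolding n_def ennreal_of_nat_eq_real_of_nat by simp
      finally show ?thesis .
    qed
    then show ?thesis
      by (intro nn_integral_mono mult_right_mono) (auto simp: mult.commute intro: mult_left_mono)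
  qed
  also have "\<dots> = ennreal (8 * n + 1) * (\<integral>\<^sup>+y\<in>?I. (\<integral>\<^sup>+x\<in>?I. kern x y \<partial>lebesgue) \<partial>lebesgue)"
  proof -
    have m: "(\<lambda>x. kern x y) \<in> borel_measurable lebesgue" for y
      unfolding kern_def by measurable
    have [measurable]: "(\<lambda>y. \<integral>\<^sup>+x\<in>?I. kern x y \<partial>lebesgue) \<in> borel_measurable lebesgue"
      using lebesgue.borel_measurable_nn_integral[of "\<lambda>y x. kern x y * indicator ?I x" lebesgue] by simp
    show ?thesis using m by (simp add: nn_integral_cmult mult.assoc)
  qed
  finally have T: "(\<Sum>k. T k) \<le> \<dots>" .
  have "(\<Sum>k. ennreal (2 powr ((\<theta> - 2 * n) * real k)) *
      (\<Sum>p\<in>grid k. double_osc f (?J k p) 0 / ennreal (((l / 2 ^ k) ^ CARD('n))\<^sup>2)))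
    \<le> (\<Sum>k. ennreal (?C * l powr (\<theta> - 2 * n)) * T k)"
    by (intro suminf_le summand) auto
  also have "\<dots> = ennreal (?C * l powr (\<theta> - 2 * n)) * (\<Sum>k. T k)" by simp
  also have "\<dots> \<le> ennreal (?C * l powr (\<theta> - 2 * n)) * (ennreal (8 * n + 1) * (\<integral>\<^sup>+y\<in>?I. (\<integral>\<^sup>+x\<in>?I. kern x y \<partial>lebesgue) \<partial>lebesgue))"
    using T by (intro mult_left_mono) auto
  also have "\<dots> = ennreal (?C * (8 * n + 1)) * (ennreal (l powr (\<theta> - 2 * n)) * (\<integral>\<^sup>+y\<in>?I. (\<integral>\<^sup>+x\<in>?I. kern x y \<partial>lebesgue) \<partial>lebesgue))"
    using n1 by (simp add: ennreal_mult mult_ac)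
  finally show ?thesis .
qed

section \<open>Means, variances and dyadic approximation\<close>

definition mean :: "('a::euclidean_space \<Rightarrow> real) \<Rightarrow> 'a set \<Rightarrow> real" where
  "mean g S = (LINT x:S|lebesgue. g x) / measure lebesgue S"

text \<open>Second moments are used because the means of \<open>g\<close> and of its square both
  average over the children of a cube, so \<open>mean_grid_Suc\<close> covers both.\<close>

definition var :: "('a::euclidean_space \<Rightarrow> real) \<Rightarrow> 'a set \<Rightarrow> real" where
  "var g S = mean (\<lambda>x. (g x)\<^sup>2) S - (mean g S)\<^sup>2"

lemma set_integrable_const_lebesgue:
  "S \<in> sets lebesgue \<Longrightarrow> emeasure lebesgue S < \<infinity> \<Longrightarrow> set_integrable lebesgue S (\<lambda>_. c::real)"
  by (simp add: set_integrable_def)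

lemma emeasure_hcube_finite: "0 < l \<Longrightarrow> emeasure lebesgue (hcube (a::real^'n) l) < \<infinity>"
  by (simp add: emeasure_hcube)

text \<open>The function is clamped to \<open>[-M, M]\<close>, then replaced by a clamped continuous
  function from a sequence converging almost everywhere. Dominated convergence controls both errors
  by \<open>e / 2\<close>.\<close>

lemma continuous_L1_approx:
  fixes g :: "'a::euclidean_space \<Rightarrow> real"
  assumes g: "set_integrable lebesgue S g" and S [measurable]: "S \<in> sets lebesgue" and fin: "emeasure lebesgue S < \<infinity>"
    and e: "0 < e"
  obtains \<phi> where "continuous_on UNIV \<phi>" "set_integrable lebesgue S \<phi>" "(LINT x:S|lebesgue. \<bar>g x - \<phi> x\<bar>) < e"
proof -
  define G where "G x = indicator S x * g x" for x
  have G: "integrable lebesgue G" using g by (simp add: set_integrable_def G_def[abs_def])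
  then have Gm [measurable]: "G \<in> borel_measurable lebesgue" by auto
  define cl where "cl M t = max (- M) (min M t)" for M t :: real
  have clm: "(\<lambda>x. cl M (u x)) \<in> borel_measurable lebesgue" if "u \<in> borel_measurable lebesgue" for M u
    using that unfolding cl_def by measurable
  have cl0: "cl M 0 = 0" if "0 \<le> M" for M using that by (simp add: cl_def)
  have "(\<lambda>M. LINT x|lebesgue. \<bar>G x - cl (real M) (G x)\<bar>) \<longlonglongrightarrow> (LINT x|(lebesgue::'a measure). (0::real))"
  proof (rule integral_dominated_convergence)
    show "integrable lebesgue (\<lambda>x. \<bar>G x\<bar>)" using G by simp
    show "AE x in lebesgue. norm \<bar>G x - cl (real M) (G x)\<bar> \<le> \<bar>G x\<bar>" for M
      by (rule AE_I2) (auto simp: cl_def min_def max_def)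
    show "AE x in lebesgue. (\<lambda>M. \<bar>G x - cl (real M) (G x)\<bar>) \<longlonglongrightarrow> 0"
    proof (rule AE_I2)
      fix x
      have "eventually (\<lambda>M. real M \<ge> \<bar>G x\<bar>) sequentially"
        using eventually_ge_at_top[of "nat \<lceil>\<bar>G x\<bar>\<rceil>"] by eventually_elim linarith
      then have "eventually (\<lambda>M. \<bar>G x - cl (real M) (G x)\<bar> = 0) sequentially"
        by eventually_elim (auto simp: cl_def min_def max_def)
      then show "(\<lambda>M. \<bar>G x - cl (real M) (G x)\<bar>) \<longlonglongrightarrow> 0" by (rule tendsto_eventually)
    qed
    show "(\<lambda>x. \<bar>G x - cl (real M) (G x)\<bar>) \<in> borel_measurable lebesgue" for M
      using clm[OF Gm, of "real M"] by measurable
  qed auto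
  then have "eventually (\<lambda>M. (LINT x|lebesgue. \<bar>G x - cl (real M) (G x)\<bar>) < e / 2) sequentially"
    using e by (intro order_tendstoD) auto
  then obtain m where m: "(LINT x|lebesgue. \<bar>G x - cl (real m) (G x)\<bar>) < e / 2"
    by (auto simp: eventually_sequentially)
  define M where "M = real m"
  have M0: "0 \<le> M" by (simp add: M_def)
  have "G measurable_on UNIV" by (rule lebesgue_measurable_imp_measurable_on_real) auto
  then obtain N u where N: "negligible N" and u: "\<And>n. continuous_on UNIV (u n)"
    and lim: "\<And>x. x \<notin> N \<Longrightarrow> (\<lambda>n. u n x) \<longlonglongrightarrow> G x"
    unfolding measurable_on_def by auto
  have um [measurable]: "u n \<in> borel_measurable lebesgue" for n
    using u continuous_imp_measurable_on_sets_lebesgue[of UNIV "u n"] by (simp add: lebesgue_on_UNIV_eq)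
  have clc: "continuous_on UNIV (\<lambda>x. cl M (u n x))" for n
    unfolding cl_def using u by (intro continuous_intros)
  \<comment> \<open>Clamping the approximants as well supplies the dominating function
    \<open>2 * M\<close> on the set \<open>S\<close> of finite measure.\<close>
  have "(\<lambda>n. LINT x|lebesgue. indicator S x * \<bar>cl M (G x) - cl M (u n x)\<bar>) \<longlonglongrightarrow> (LINT x|(lebesgue::'a measure). (0::real))"
  proof (rule integral_dominated_convergence)
    show "integrable lebesgue (\<lambda>x. indicator S x * (2 * M))" using fin by simp
    show "AE x in lebesgue. norm (indicator S x * \<bar>cl M (G x) - cl M (u n x)\<bar>) \<le> indicator S x * (2 * M)" for n
      by (rule AE_I2) (use M0 in \<open>auto simp: cl_def min_def max_def indicator_def\<close>)
    have "AE x in lebesgue. x \<notin> N" using N AE_not_in negligible_iff_null_sets by blast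
    then show "AE x in lebesgue. (\<lambda>n. indicator S x * \<bar>cl M (G x) - cl M (u n x)\<bar>) \<longlonglongrightarrow> 0"
    proof eventually_elim
      fix x assume "x \<notin> N"
      from lim[OF this] have "(\<lambda>n. indicator S x * \<bar>cl M (G x) - cl M (u n x)\<bar>) \<longlonglongrightarrow> indicator S x * \<bar>cl M (G x) - cl M (G x)\<bar>"
        unfolding cl_def by (intro tendsto_intros)
      then show "(\<lambda>n. indicator S x * \<bar>cl M (G x) - cl M (u n x)\<bar>) \<longlonglongrightarrow> 0" by simp
    qed
    show "(\<lambda>x. indicator S x * \<bar>cl M (G x) - cl M (u n x)\<bar>) \<in> borel_measurable lebesgue" for n
      using clm[OF Gm, of M] clm[OF um, of M n] by measurable
  qed auto
  then have "eventually (\<lambda>n. (LINT x|lebesgue. indicator S x * \<bar>cl M (G x) - cl M (u n x)\<bar>) < e / 2) sequentially"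
    using e by (intro order_tendstoD) auto
  then obtain n where n: "(LINT x|lebesgue. indicator S x * \<bar>cl M (G x) - cl M (u n x)\<bar>) < e / 2"
    by (auto simp: eventually_sequentially)
  have cM: "\<bar>cl M t\<bar> \<le> M" for t using M0 by (auto simp: cl_def min_def max_def)
  have i0: "integrable lebesgue (\<lambda>x. indicator S x * M)" using fin by simp
  have i1: "integrable lebesgue (\<lambda>x. indicator S x * cl M (u n x))"
    by (rule Bochner_Integration.integrable_bound[OF i0]) (use clm[OF um, of M n] cM M0 in \<open>auto simp: indicator_def\<close>)
  have i2: "integrable lebesgue (\<lambda>x. cl M (G x))"
    by (rule Bochner_Integration.integrable_bound[OF G]) (use clm[OF Gm, of M] M0 in \<open>auto simp: cl_def min_def max_def\<close>)

  have "(LINT x:S|lebesgue. \<bar>g x - cl M (u n x)\<bar>) = (LINT x|lebesgue. \<bar>G x - indicator S x * cl M (u n x)\<bar>)"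
    unfolding set_lebesgue_integral_def by (intro Bochner_Integration.integral_cong) (auto simp: G_def indicator_def)
  also have "\<dots> \<le> (LINT x|lebesgue. \<bar>G x - cl M (G x)\<bar> + \<bar>cl M (G x) - indicator S x * cl M (u n x)\<bar>)"
    using G i1 i2 by (intro integral_mono) auto
  also have "\<dots> = (LINT x|lebesgue. \<bar>G x - cl M (G x)\<bar>) + (LINT x|lebesgue. \<bar>cl M (G x) - indicator S x * cl M (u n x)\<bar>)"
    using G i1 i2 by (intro Bochner_Integration.integral_add) auto
  also have "(LINT x|lebesgue. \<bar>cl M (G x) - indicator S x * cl M (u n x)\<bar>) = (LINT x|lebesgue. indicator S x * \<bar>cl M (G x) - cl M (u n x)\<bar>)"
    by (intro Bochner_Integration.integral_cong) (auto simp: G_def indicator_def cl0[OF M0])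
  finally have "(LINT x:S|lebesgue. \<bar>g x - cl M (u n x)\<bar>) < e" using n m unfolding M_def by linarith
  moreover have "set_integrable lebesgue S (\<lambda>x. cl M (u n x))" using i1 by (simp add: set_integrable_def)
  ultimately show thesis using that clc by blast
qed

text \<open>The mean is an optimal constant in L1 up to a factor 2: its distance to
  \<open>c\<close>, times the measure of \<open>S\<close>, is at most the integral of
  \<open>\<bar>g x - c\<bar>\<close>.\<close>

lemma integral_abs_diff_mean_le:
  fixes g :: "'a::euclidean_space \<Rightarrow> real"
  assumes g: "set_integrable lebesgue S g" and S: "S \<in> sets lebesgue" "emeasure lebesgue S < \<infinity>" "measure lebesgue S \<noteq> 0"
  shows "(LINT x:S|lebesgue. \<bar>g x - mean g S\<bar>) \<le> 2 * (LINT x:S|lebesgue. \<bar>g x - c\<bar>)"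
proof -
  note const = set_integrable_const_lebesgue[OF S(1,2)]
  have ga: "set_integrable lebesgue S (\<lambda>x. \<bar>g x - d\<bar>)" for d
    by (intro set_integrable_abs set_integral_diff g const)
  have intc: "(LINT x:S|lebesgue. d) = measure lebesgue S * d" for d :: real
    using S by (simp add: set_integral_const)
  have "measure lebesgue S * (mean g S - c) = (LINT x:S|lebesgue. g x - c)"
    using S(3) g const by (simp add: mean_def intc algebra_simps)
  also have "\<bar>\<dots>\<bar> \<le> (LINT x:S|lebesgue. \<bar>g x - c\<bar>)"
    unfolding set_lebesgue_integral_def by (rule order_trans[OF integral_abs_bound]) (auto simp: abs_mult)
  finally have b: "measure lebesgue S * \<bar>c - mean g S\<bar> \<le> (LINT x:S|lebesgue. \<bar>g x - c\<bar>)"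
    by (simp add: abs_mult abs_minus_commute)
  have "(LINT x:S|lebesgue. \<bar>g x - mean g S\<bar>) \<le> (LINT x:S|lebesgue. \<bar>g x - c\<bar> + \<bar>c - mean g S\<bar>)"
    by (intro set_integral_mono ga set_integral_add const) auto
  also have "\<dots> = (LINT x:S|lebesgue. \<bar>g x - c\<bar>) + measure lebesgue S * \<bar>c - mean g S\<bar>"
    using ga const by (simp add: intc)
  finally show ?thesis using b by simp
qed

lemma hcube_grid_subset: "0 < l \<Longrightarrow> p \<in> grid k \<Longrightarrow> hcube (corner a l k p) (l / 2 ^ k) \<subseteq> hcube a l"
  using hcube_grid_UN[of l a k] by auto

lemma sum_integral_grid:
  fixes g :: "real^'n \<Rightarrow> real"
  assumes "set_integrable lebesgue (hcube a l) g" "0 < l"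
  shows "(\<Sum>p\<in>grid k. LINT x:hcube (corner a l k p) (l / 2 ^ k)|lebesgue. g x) = (LINT x:hcube a l|lebesgue. g x)"
proof -
  have "(LINT x:hcube a l|lebesgue. g x) = (LINT x:(\<Union>p\<in>grid k. hcube (corner a l k p) (l / 2 ^ k))|lebesgue. g x)"
    using hcube_grid_UN[OF assms(2), of a k] by simp
  also have "\<dots> = (\<Sum>p\<in>grid k. LINT x:hcube (corner a l k p) (l / 2 ^ k)|lebesgue. g x)"
    by (rule set_integral_finite_Union)
      (use disjoint_hcube_grid[OF assms(2)] set_integrable_subset[OF assms(1) hcube_lebesgue hcube_grid_subset[OF assms(2)]] in auto)
  finally show ?thesis by simp
qed

lemma sum_measure_grid:
  "0 < (l::real) \<Longrightarrow> (\<Sum>p\<in>(grid k :: ('n::finite \<Rightarrow> nat) set). (l / 2 ^ k) ^ CARD('n)) = l ^ CARD('n)"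
  by (simp add: card_grid power_divide power_mult)

text \<open>Takes the place of Lebesgue differentiation when passing from dyadic means back to
  \<open>g\<close>. On a small cell a continuous approximant is nearly constant, and by
  \<open>integral_abs_diff_mean_le\<close> the mean does almost as well as that constant.\<close>

lemma dyadic_L1_convergence:
  fixes g :: "real^'n \<Rightarrow> real"
  assumes g: "set_integrable lebesgue (hcube a l) g" and l: "0 < l" and e: "0 < e"
  obtains k where "(\<Sum>p\<in>grid k. LINT x:hcube (corner a l k p) (l / 2 ^ k)|lebesgue.
      \<bar>g x - mean g (hcube (corner a l k p) (l / 2 ^ k))\<bar>) < e"
proof -
  let ?I = "hcube a l"
  obtain \<phi> where \<phi>: "continuous_on UNIV \<phi>" "set_integrable lebesgue ?I \<phi>" "(LINT x:?I|lebesgue. \<bar>g x - \<phi> x\<bar>) < e / 4"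
    using continuous_L1_approx[OF g, of "e / 4"] l e by (auto simp: emeasure_hcube)
  \<comment> \<open>Chosen so that the oscillation of the approximant contributes
    \<open>2 * w * l ^ CARD('n) = e / 2\<close>; the approximation error contributes less than the
    other half.\<close>
  define w where "w = e / (4 * l ^ CARD('n))"
  have w: "0 < w" using e l by (simp add: w_def)
  have "compact (cube a l)" by (simp add: cube_def compact_cbox)
  then have "uniformly_continuous_on (cube a l) \<phi>"
    using \<phi>(1) by (intro compact_uniformly_continuous) (auto intro: continuous_on_subset)
  then obtain d where d: "0 < d" "\<And>x y. x \<in> cube a l \<Longrightarrow> y \<in> cube a l \<Longrightarrow> dist x y < d \<Longrightarrow> dist (\<phi> x) (\<phi> y) < w"
    using w unfolding uniformly_continuous_on_def by metis
  obtain k where k: "real CARD('n) * l / d < 2 ^ k"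
    using real_arch_pow[of 2 "real CARD('n) * l / d"] by auto
  let ?h = "l / 2 ^ k"
  let ?J = "\<lambda>p. hcube (corner a l k p) ?h"
  have h: "0 < ?h" "real CARD('n) * ?h < d" using l d k by (auto simp: field_simps)
  have each: "(LINT x:?J p|lebesgue. \<bar>g x - mean g (?J p)\<bar>) \<le> 2 * (LINT x:?J p|lebesgue. \<bar>g x - \<phi> x\<bar>) + 2 * (w * ?h ^ CARD('n))"
    if p: "p \<in> grid k" for p
  proof -
    let ?c = "\<phi> (corner a l k p)"
    have JI: "?J p \<subseteq> ?I" using hcube_grid_subset[OF l p] .
    have gJ: "set_integrable lebesgue (?J p) g" and fJ: "set_integrable lebesgue (?J p) \<phi>"
      using g \<phi>(2) JI by (auto intro: set_integrable_subset)
    have fin: "emeasure lebesgue (?J p) < \<infinity>" using emeasure_hcube_finite[OF h(1)] .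
    have const: "set_integrable lebesgue (?J p) (\<lambda>_. c)" for c :: real
      using fin by (intro set_integrable_const_lebesgue) auto
    have cJ: "corner a l k p \<in> ?J p" using h(1) by (simp add: hcube_def)
    have near: "\<bar>\<phi> x - ?c\<bar> \<le> w" if x: "x \<in> ?J p" for x
    proof -
      have "dist x (corner a l k p) < d"
        using norm_diff_hcube[OF x cJ] h(2) by (simp add: dist_norm)
      moreover have "x \<in> cube a l" "corner a l k p \<in> cube a l" using x cJ JI hcube_subset_cube[of a l] by blast+
      ultimately show ?thesis using d(2)[of x "corner a l k p"] by (simp add: dist_real_def)
    qed
    have "(LINT x:?J p|lebesgue. \<bar>g x - mean g (?J p)\<bar>) \<le> 2 * (LINT x:?J p|lebesgue. \<bar>g x - ?c\<bar>)"
      using gJ fin h(1) measure_hcube[of ?h "corner a l k p"] by (intro integral_abs_diff_mean_le) auto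
    also have "(LINT x:?J p|lebesgue. \<bar>g x - ?c\<bar>) \<le> (LINT x:?J p|lebesgue. \<bar>g x - \<phi> x\<bar> + w)"
    proof (rule set_integral_mono)
      show "\<bar>g x - ?c\<bar> \<le> \<bar>g x - \<phi> x\<bar> + w" if "x \<in> ?J p" for x using near[OF that] by linarith
    qed (intro set_integrable_abs set_integral_diff set_integral_add gJ fJ const)+
    also have "\<dots> = (LINT x:?J p|lebesgue. \<bar>g x - \<phi> x\<bar>) + (LINT x:?J p|lebesgue. w)"
      by (intro set_integral_add set_integrable_abs set_integral_diff gJ fJ const)
    also have "(LINT x:?J p|lebesgue. w) = w * ?h ^ CARD('n)"
      using fin h(1) by (simp add: set_integral_const measure_hcube)
    finally show ?thesis by simp
  qed
  have "(\<Sum>p\<in>grid k. LINT x:?J p|lebesgue. \<bar>g x - mean g (?J p)\<bar>)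
    \<le> (\<Sum>p\<in>grid k. 2 * (LINT x:?J p|lebesgue. \<bar>g x - \<phi> x\<bar>) + 2 * (w * ?h ^ CARD('n)))"
    by (intro sum_mono each)
  also have "\<dots> = 2 * (\<Sum>p\<in>grid k. LINT x:?J p|lebesgue. \<bar>g x - \<phi> x\<bar>) + 2 * (w * (\<Sum>p\<in>(grid k :: ('n \<Rightarrow> nat) set). ?h ^ CARD('n)))"
    by (simp add: sum.distrib sum_distrib_left)
  also have "(\<Sum>p\<in>grid k. LINT x:?J p|lebesgue. \<bar>g x - \<phi> x\<bar>) = (LINT x:?I|lebesgue. \<bar>g x - \<phi> x\<bar>)"
    by (intro sum_integral_grid set_integrable_abs set_integral_diff g \<phi>(2) l)
  also have "2 * (w * (\<Sum>p\<in>(grid k :: ('n \<Rightarrow> nat) set). ?h ^ CARD('n))) = e / 2"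
    using l unfolding sum_measure_grid[OF l] w_def by simp
  finally show thesis using \<phi>(3) that[of k] by simp
qed

section \<open>A dyadic John-Nirenberg inequality\<close>

text \<open>For \<open>x = - y < 0\<close> it suffices that
  \<open>(1 - y + y\<^sup>2) * exp y \<ge> 1\<close>, which already holds with \<open>exp y\<close>
  replaced by its quadratic Taylor polynomial.\<close>

lemma exp_le_quadratic:
  fixes x :: real
  assumes "\<bar>x\<bar> \<le> 1"
  shows "exp x \<le> 1 + x + x\<^sup>2"
proof (cases "0 \<le> x")
  case True
  then show ?thesis using exp_bound[of x] assms by simp
next
  case False
  define y where "y = - x"
  have y: "0 \<le> y" using False by (simp add: y_def)
  have "1 \<le> (1 - y + y\<^sup>2) * (1 + y + y\<^sup>2 / 2)"
  proof -
    have "(1 - y + y\<^sup>2) * (1 + y + y\<^sup>2 / 2) = 1 + y\<^sup>2 / 2 + y ^ 3 / 2 + y ^ 4 / 2"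
      by (simp add: field_simps power2_eq_square power3_eq_cube power4_eq_xxxx)
    then show ?thesis using y by simp
  qed
  also have "\<dots> \<le> (1 - y + y\<^sup>2) * exp y"
  proof (rule mult_left_mono)
    show "1 + y + y\<^sup>2 / 2 \<le> exp y" using exp_lower_Taylor_quadratic[OF y] by simp
    have "0 \<le> (y - 1/2)\<^sup>2" by simp
    then show "0 \<le> 1 - y + y\<^sup>2" by (simp add: power2_eq_square algebra_simps)
  qed
  finally have "exp (- y) \<le> 1 - y + y\<^sup>2"
    by (simp add: exp_minus field_simps)
  then show ?thesis by (simp add: y_def)
qed

text \<open>
  A Bellman function: \<open>exp m * bellman v\<close> majorises the average of \<open>exp\<close> over a cube with mean \<open>m\<close> and
  variance \<open>v\<close>.  By the tangent estimate below, its average over the subcubes of a cube is at most its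
  value on the cube; the term \<open>- 9 * v\<^sup>2\<close> absorbs the mixed product of the jump of the mean and the
  change of the variance.
\<close>

definition bellman :: "real \<Rightarrow> real" where "bellman v = 1 + 4 * v - 9 * v\<^sup>2"

lemma one_le_bellman:
  assumes "0 \<le> v" "v \<le> 1/32"
  shows "1 \<le> bellman v"
proof -
  have "v * v \<le> 1/32 * v" using assms by (intro mult_right_mono) auto
  then show ?thesis unfolding bellman_def power2_eq_square using assms by linarith
qed

text \<open>\<open>4 - 18 * v\<close> is the derivative of \<open>bellman\<close>. The right side is
  affine in \<open>d\<close> and in \<open>w + d\<^sup>2\<close>, whose averages over the children
  are 0 and \<open>v\<close>; so on summation only the value at the parent survives.\<close>

lemma bellman_tangent:
  fixes v w d :: real
  assumes v: "0 \<le> v" "v \<le> 1/32" and w: "0 \<le> w" "w \<le> 1/32" and d: "\<bar>d\<bar> \<le> 1/4"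
  shows "exp d * bellman w \<le> bellman v + bellman v * d + (4 - 18 * v) * (w + d\<^sup>2 - v)"
proof -
  define u where "u = w - v"
  have w_eq: "w = v + u" by (simp add: u_def)
  have v2: "v\<^sup>2 \<le> v" and w2: "w\<^sup>2 \<le> w"
    using v w by (auto simp: power2_eq_square intro: mult_left_le)
  have h0: "0 \<le> bellman w" using w w2 unfolding bellman_def by linarith
  have h1: "bellman v \<le> 9/8" using v zero_le_power2[of v] unfolding bellman_def by linarith
  have main: "\<bar>d + d\<^sup>2\<bar> \<le> 5/4 * \<bar>d\<bar>"
  proof -
    have "\<bar>d + d\<^sup>2\<bar> \<le> \<bar>d\<bar> + \<bar>d\<bar> * \<bar>d\<bar>" using abs_triangle_ineq[of d "d * d"] by (simp add: power2_eq_square abs_mult)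
    also have "\<bar>d\<bar> * \<bar>d\<bar> \<le> 1/4 * \<bar>d\<bar>" using d by (intro mult_right_mono) auto
    finally show ?thesis by simp
  qed
  have q: "3/4 \<le> 1 + d + d\<^sup>2" using d zero_le_power2[of d] by linarith
  have cross: "(d + d\<^sup>2) * ((4 - 18 * v) * u) \<le> 5 * \<bar>d\<bar> * \<bar>u\<bar>"
  proof -
    have "(d + d\<^sup>2) * ((4 - 18 * v) * u) \<le> \<bar>d + d\<^sup>2\<bar> * (\<bar>4 - 18 * v\<bar> * \<bar>u\<bar>)"
      using abs_ge_self[of "(d + d\<^sup>2) * ((4 - 18 * v) * u)"] by (simp only: abs_mult)
    also have "\<dots> \<le> (5/4 * \<bar>d\<bar>) * (4 * \<bar>u\<bar>)"
      using v by (intro mult_mono main) auto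
    finally show ?thesis by simp
  qed
  \<comment> \<open>The remainder is at least \<open>2 * d\<^sup>2 - 5 * \<bar>d\<bar> *
    \<bar>u\<bar> + 27/4 * u\<^sup>2\<close>. Completing the square needs only \<open>25/8\<close>
    for the last coefficient.\<close>
  have "2 * (\<bar>d\<bar> - 5/4 * \<bar>u\<bar>)\<^sup>2 = 2 * d\<^sup>2 - 5 * \<bar>d\<bar> * \<bar>u\<bar> + 25/8 * u\<^sup>2"
    by (simp add: power2_eq_square algebra_simps)
  moreover have "0 \<le> 2 * (\<bar>d\<bar> - 5/4 * \<bar>u\<bar>)\<^sup>2" by simp
  ultimately have sq: "5 * \<bar>d\<bar> * \<bar>u\<bar> \<le> 2 * d\<^sup>2 + 27/4 * u\<^sup>2"
    using zero_le_power2[of u] by linarith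
  have a: "2 * d\<^sup>2 \<le> (4 - 18 * v - bellman v) * d\<^sup>2"
    using v h1 by (intro mult_right_mono) auto
  have b: "27/4 * u\<^sup>2 \<le> 9 * (1 + d + d\<^sup>2) * u\<^sup>2"
    using q by (intro mult_right_mono) auto
  have e: "bellman w = bellman v + (4 - 18 * v) * u - 9 * u\<^sup>2"
    by (simp add: bellman_def w_eq power2_eq_square algebra_simps)
  have "exp d * bellman w \<le> (1 + d + d\<^sup>2) * bellman w"
    using d by (intro mult_right_mono exp_le_quadratic h0) auto
  also have "\<dots> = bellman v + bellman v * d + (4 - 18 * v) * (w + d\<^sup>2 - v)
      - ((4 - 18 * v - bellman v) * d\<^sup>2 - (d + d\<^sup>2) * ((4 - 18 * v) * u) + 9 * (1 + d + d\<^sup>2) * u\<^sup>2)"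
    unfolding e by (simp add: w_eq algebra_simps)
  also have "\<dots> \<le> bellman v + bellman v * d + (4 - 18 * v) * (w + d\<^sup>2 - v)"
    using a b cross sq by linarith
  finally show ?thesis .
qed

text \<open>The law of total variance: the variances of the parts plus the squared jumps of their
  means average to the total variance.\<close>

lemma variance_decomposition:
  fixes m q :: "'e \<Rightarrow> real"
  assumes "finite E" "E \<noteq> {}" and m: "real (card E) * M = (\<Sum>e\<in>E. m e)" and q: "real (card E) * Q = (\<Sum>e\<in>E. q e)"
  shows "(\<Sum>e\<in>E. (q e - (m e)\<^sup>2) + (m e - M)\<^sup>2) = real (card E) * (Q - M\<^sup>2)"
proof -
  have "(\<Sum>e\<in>E. (q e - (m e)\<^sup>2) + (m e - M)\<^sup>2) = (\<Sum>e\<in>E. q e - 2 * M * m e + M\<^sup>2)"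
    by (intro sum.cong) (auto simp: power2_eq_square algebra_simps)
  also have "\<dots> = (\<Sum>e\<in>E. q e) - 2 * M * (\<Sum>e\<in>E. m e) + real (card E) * M\<^sup>2"
    by (simp add: sum.distrib sum_subtractf sum_distrib_left)
  also have "\<dots> = real (card E) * (Q - M\<^sup>2)"
    unfolding m[symmetric] q[symmetric] by (simp add: power2_eq_square algebra_simps)
  finally show ?thesis .
qed

lemma sum_affine:
  fixes f g :: "'e \<Rightarrow> real"
  shows "(\<Sum>e\<in>E. a + b * (f e - M) + c * (g e - V)) =
    real (card E) * a + b * ((\<Sum>e\<in>E. f e) - real (card E) * M) + c * ((\<Sum>e\<in>E. g e) - real (card E) * V)"
  by (simp add: sum.distrib sum_subtractf right_diff_distrib sum_distrib_left)

text \<open>\<open>bellman_tangent\<close> is summed over the children with \<open>d\<close> the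
  jump of the mean and \<open>w\<close> the child variance; both affine terms vanish by the choice
  of \<open>M\<close> and by \<open>variance_decomposition\<close>.\<close>

lemma bellman_step:
  fixes m q :: "'e \<Rightarrow> real"
  assumes E: "finite E" "E \<noteq> {}"
    and m: "real (card E) * M = (\<Sum>e\<in>E. m e)" and q: "real (card E) * Q = (\<Sum>e\<in>E. q e)"
    and V: "0 \<le> Q - M\<^sup>2" "Q - M\<^sup>2 \<le> 1 / (16 * real (card E))" "Q - M\<^sup>2 \<le> 1/32"
    and v: "\<And>e. e \<in> E \<Longrightarrow> 0 \<le> q e - (m e)\<^sup>2" "\<And>e. e \<in> E \<Longrightarrow> q e - (m e)\<^sup>2 \<le> 1/32"
  shows "(\<Sum>e\<in>E. exp (m e) * bellman (q e - (m e)\<^sup>2)) \<le> real (card E) * (exp M * bellman (Q - M\<^sup>2))"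
proof -
  have N: "real (card E) > 0" using E by (simp add: card_gt_0_iff)
  note vd = variance_decomposition[OF E m q]
  \<comment> \<open>A single squared jump is at most the whole sum, hence at most
    \<open>1/16\<close>. The bound with the number of children in the denominator serves exactly
    this.\<close>
  have jump: "\<bar>m e - M\<bar> \<le> 1/4" if "e \<in> E" for e
  proof -
    have "(m e - M)\<^sup>2 \<le> (q e - (m e)\<^sup>2) + (m e - M)\<^sup>2" using v(1)[OF that] by simp
    also have "\<dots> \<le> (\<Sum>e\<in>E. (q e - (m e)\<^sup>2) + (m e - M)\<^sup>2)"
      by (rule member_le_sum) (use that v(1) E in auto)
    also have "\<dots> \<le> real (card E) * (1 / (16 * real (card E)))"
      unfolding vd using N by (intro mult_left_mono V) auto
    also have "\<dots> = (1/4)\<^sup>2" using N by (simp add: power2_eq_square)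
    finally show ?thesis by (rule power2_le_iff_abs_le[THEN iffD1, rotated]) simp
  qed
  let ?V = "Q - M\<^sup>2"
  have "(\<Sum>e\<in>E. exp (m e) * bellman (q e - (m e)\<^sup>2)) = exp M * (\<Sum>e\<in>E. exp (m e - M) * bellman (q e - (m e)\<^sup>2))"
    by (simp add: sum_distrib_left mult.assoc[symmetric] exp_add[symmetric])
  moreover have "(\<Sum>e\<in>E. exp (m e - M) * bellman (q e - (m e)\<^sup>2)) \<le> real (card E) * bellman ?V"
  proof -
    have "(\<Sum>e\<in>E. exp (m e - M) * bellman (q e - (m e)\<^sup>2)) \<le>
      (\<Sum>e\<in>E. bellman ?V + bellman ?V * (m e - M) + (4 - 18 * ?V) * ((q e - (m e)\<^sup>2) + (m e - M)\<^sup>2 - ?V))"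
    by (intro sum_mono bellman_tangent jump V v)
  also have "\<dots> = real (card E) * bellman ?V + bellman ?V * ((\<Sum>e\<in>E. m e) - real (card E) * M)
      + (4 - 18 * ?V) * ((\<Sum>e\<in>E. (q e - (m e)\<^sup>2) + (m e - M)\<^sup>2) - real (card E) * ?V)"
    by (rule sum_affine)
    also have "\<dots> = real (card E) * bellman ?V"
      unfolding vd m by simp
    finally show ?thesis .
  qed
  ultimately show ?thesis by (simp add: mult.left_commute)
qed

lemma grid_0: "grid 0 = {\<lambda>_. 0}"
  by (auto simp: grid_def)

text \<open>Stated for abstract first and second moments on the tree, so that it also applies to
  \<open>- m\<close> with the same \<open>q\<close>.\<close>

lemma bellman_chain:
  fixes m q :: "nat \<Rightarrow> ('n::finite \<Rightarrow> nat) \<Rightarrow> real"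
  assumes m: "\<And>k p. p \<in> grid k \<Longrightarrow> 2 ^ CARD('n) * m k p = (\<Sum>e\<in>grid 1. m (Suc k) (child p e))"
    and q: "\<And>k p. p \<in> grid k \<Longrightarrow> 2 ^ CARD('n) * q k p = (\<Sum>e\<in>grid 1. q (Suc k) (child p e))"
    and V: "\<And>k p. p \<in> grid k \<Longrightarrow> 0 \<le> q k p - (m k p)\<^sup>2"
      "\<And>k p. p \<in> grid k \<Longrightarrow> q k p - (m k p)\<^sup>2 \<le> 1 / (16 * 2 ^ CARD('n))"
  shows "(\<Sum>p\<in>grid k. exp (m k p)) \<le> 2 ^ (k * CARD('n)) * (exp (m 0 (\<lambda>_. 0)) * (1 + 4 * (q 0 (\<lambda>_. 0) - (m 0 (\<lambda>_. 0))\<^sup>2)))"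
proof -
  let ?b = "\<lambda>k p. exp (m k p) * bellman (q k p - (m k p)\<^sup>2)"
  have card1: "real (card (grid 1 :: ('n \<Rightarrow> nat) set)) = 2 ^ CARD('n)" by (simp add: card_grid)
  have ne: "(grid 1 :: ('n \<Rightarrow> nat) set) \<noteq> {}" using card1 by force
  have "2 ^ 1 \<le> (2::real) ^ CARD('n)" by (intro power_increasing) auto
  then have V32: "q k p - (m k p)\<^sup>2 \<le> 1/32" if "p \<in> grid k" for k p
    using order_trans[OF V(2)[OF that], of "1/32"] by (simp add: field_simps)
  have chain: "(\<Sum>p\<in>grid k. ?b k p) \<le> 2 ^ (k * CARD('n)) * ?b 0 (\<lambda>_. 0)" for k
  proof (induction k)
    case 0 then show ?case by (simp add: grid_0)
  next
    case (Suc k)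
    have "(\<Sum>p\<in>grid (Suc k). ?b (Suc k) p) = (\<Sum>p\<in>grid k. \<Sum>e\<in>grid 1. ?b (Suc k) (child p e))"
      by (rule sum_grid_Suc)
    also have "\<dots> \<le> (\<Sum>p\<in>grid k. real (card (grid 1 :: ('n \<Rightarrow> nat) set)) * ?b k p)"
    proof (rule sum_mono)
      fix p :: "'n \<Rightarrow> nat" assume p: "p \<in> grid k"
      have ch: "child p e \<in> grid (Suc k)" if "e \<in> grid 1" for e
        using child_in_grid[of p k e] p that by (simp add: child_def)
      show "(\<Sum>e\<in>grid 1. ?b (Suc k) (child p e)) \<le> real (card (grid 1 :: ('n \<Rightarrow> nat) set)) * ?b k p"
      proof (rule bellman_step)
        show "q k p - (m k p)\<^sup>2 \<le> 1 / (16 * real (card (grid 1 :: ('n \<Rightarrow> nat) set)))"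
          unfolding card1 using V(2) p .
      qed (use ne m[OF p] q[OF p] V(1)[OF p] V32[OF p] V(1)[OF ch] V32[OF ch] card1 in auto)
    qed
    also have "\<dots> = 2 ^ CARD('n) * (\<Sum>p\<in>grid k. ?b k p)" unfolding card1 by (simp add: sum_distrib_left)
    also have "\<dots> \<le> 2 ^ CARD('n) * (2 ^ (k * CARD('n)) * ?b 0 (\<lambda>_. 0))"
      using Suc.IH by (intro mult_left_mono) auto
    finally show ?case by (simp add: power_add mult.assoc)
  qed
  have "(\<Sum>p\<in>grid k. exp (m k p)) \<le> (\<Sum>p\<in>grid k. ?b k p)"
  proof (rule sum_mono)
    fix p :: "'n \<Rightarrow> nat" assume p: "p \<in> grid k"
    have "1 \<le> bellman (q k p - (m k p)\<^sup>2)"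
      using V(1)[OF p] V32[OF p] by (rule one_le_bellman)
    then show "exp (m k p) \<le> ?b k p" by simp
  qed
  also note chain[of k]
  also have "2 ^ (k * CARD('n)) * ?b 0 (\<lambda>_. 0) \<le>
      2 ^ (k * CARD('n)) * (exp (m 0 (\<lambda>_. 0)) * (1 + 4 * (q 0 (\<lambda>_. 0) - (m 0 (\<lambda>_. 0))\<^sup>2)))"
    unfolding bellman_def by (intro mult_left_mono) auto
  finally show ?thesis .
qed

text \<open>A Chebyshev argument with the weight
  \<open>exp x + exp (- x) - 2 = 2 * (cosh x - 1)\<close>, which is nonnegative and increasing in
  \<open>\<bar>x\<bar>\<close>. Since it vanishes at 0, the bound keeps the factor
  \<open>V0\<close>.\<close>

lemma dyadic_deviation_count:
  fixes m q :: "nat \<Rightarrow> ('n::finite \<Rightarrow> nat) \<Rightarrow> real" and s :: real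
  defines "V0 \<equiv> q 0 (\<lambda>_. 0) - (m 0 (\<lambda>_. 0))\<^sup>2"
  assumes m: "\<And>k p. p \<in> grid k \<Longrightarrow> 2 ^ CARD('n) * m k p = (\<Sum>e\<in>grid 1. m (Suc k) (child p e))"
    and q: "\<And>k p. p \<in> grid k \<Longrightarrow> 2 ^ CARD('n) * q k p = (\<Sum>e\<in>grid 1. q (Suc k) (child p e))"
    and V: "\<And>k p. p \<in> grid k \<Longrightarrow> 0 \<le> q k p - (m k p)\<^sup>2"
      "\<And>k p. p \<in> grid k \<Longrightarrow> q k p - (m k p)\<^sup>2 \<le> 1 / (16 * 2 ^ CARD('n))"
    and s: "0 < s"
  shows "real (card {p\<in>grid k. s \<le> \<bar>m k p - m 0 (\<lambda>_. 0)\<bar>}) * (exp s + exp (- s) - 2) \<le> 2 ^ (k * CARD('n)) * (8 * V0)"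
proof -
  let ?M = "m 0 (\<lambda>_. 0)" and ?S = "{p\<in>grid k. s \<le> \<bar>m k p - m 0 (\<lambda>_. 0)\<bar>}"
  let ?c = "\<lambda>x::real. exp x + exp (- x) - 2"
  have c_nonneg: "0 \<le> ?c x" for x
  proof -
    have "?c x = (exp (x / 2) - exp (- x / 2))\<^sup>2"
      by (simp add: power2_eq_square algebra_simps exp_add[symmetric])
    then show ?thesis by simp
  qed
  have c_mono: "?c s \<le> ?c x" if "s \<le> \<bar>x\<bar>" for x
  proof -
    have "cosh s \<le> cosh \<bar>x\<bar>" using that s by (subst cosh_real_nonneg_le_iff) auto
    also have "\<dots> = cosh x" by (cases "0 \<le> x") auto
    finally show ?thesis by (simp add: cosh_field_def)
  qed
  have up: "(\<Sum>p\<in>grid k. exp (m k p - ?M)) \<le> 2 ^ (k * CARD('n)) * (1 + 4 * V0)"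
  proof -
    have "(\<Sum>p\<in>grid k. exp (m k p)) \<le> exp ?M * (2 ^ (k * CARD('n)) * (1 + 4 * V0))"
      using bellman_chain[of m q k, OF m q V] by (simp add: V0_def mult.left_commute)
    then show ?thesis by (simp add: exp_diff sum_divide_distrib[symmetric] pos_divide_le_eq mult.commute)
  qed
  have down: "(\<Sum>p\<in>grid k. exp (?M - m k p)) \<le> 2 ^ (k * CARD('n)) * (1 + 4 * V0)"
  proof -
    have "(\<Sum>p\<in>grid k. exp (- m k p)) \<le> exp (- ?M) * (2 ^ (k * CARD('n)) * (1 + 4 * V0))"
      using bellman_chain[of "\<lambda>k p. - m k p" q k] m q V by (simp add: V0_def mult.left_commute sum_negf)
    moreover have "(\<Sum>p\<in>grid k. exp (?M - m k p)) = exp ?M * (\<Sum>p\<in>grid k. exp (- m k p))"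
      by (simp add: sum_distrib_left exp_add[symmetric])
    ultimately show ?thesis by (simp add: exp_minus field_simps)
  qed
  have "real (card ?S) * ?c s = (\<Sum>p\<in>?S. ?c s)" by simp
  also have "\<dots> \<le> (\<Sum>p\<in>?S. ?c (m k p - ?M))" by (intro sum_mono c_mono) auto
  also have "\<dots> \<le> (\<Sum>p\<in>grid k. ?c (m k p - ?M))" proof (rule sum_mono2)
    show "0 \<le> ?c (m k p - ?M)" for p by (rule c_nonneg)
  qed auto
  \<comment> \<open>The two sums are at most \<open>1 + 4 * V0\<close> per cell; subtracting 2
    removes the constants and leaves \<open>8 * V0\<close>.\<close>
  also have "\<dots> = (\<Sum>p\<in>grid k. exp (m k p - ?M)) + (\<Sum>p\<in>grid k. exp (?M - m k p)) - 2 * 2 ^ (k * CARD('n))"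
    by (simp add: sum.distrib sum_subtractf card_grid)
  also have "\<dots> \<le> 2 ^ (k * CARD('n)) * (8 * V0)" using up down by (simp add: algebra_simps)
  finally show ?thesis .
qed

section \<open>Variance identities and Chebyshev's inequality\<close>

lemma LINT_const_lebesgue:
  "S \<in> sets lebesgue \<Longrightarrow> emeasure lebesgue S < \<infinity> \<Longrightarrow> (LINT x:S|lebesgue. c) = measure lebesgue S * (c::real)"
  by (simp add: set_integral_const)

text \<open>The parallel axis identity. It is used with \<open>c\<close> the mean, for Chebyshev,
  and with \<open>c = g y\<close>, for the double integral.\<close>

lemma set_integrable_diff_sq:
  fixes g :: "'a::euclidean_space \<Rightarrow> real"
  assumes "set_integrable lebesgue S g" "set_integrable lebesgue S (\<lambda>x. (g x)\<^sup>2)"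
    and S: "S \<in> sets lebesgue" "emeasure lebesgue S < \<infinity>"
  shows "set_integrable lebesgue S (\<lambda>x. (g x - c)\<^sup>2)"
    and "(LINT x:S|lebesgue. (g x - c)\<^sup>2) = measure lebesgue S * (var g S + (mean g S - c)\<^sup>2)"
proof -
  have eq: "(\<lambda>x. (g x - c)\<^sup>2) = (\<lambda>x. (g x)\<^sup>2 - 2 * c * g x + c\<^sup>2)"
    by (simp add: power2_eq_square algebra_simps fun_eq_iff)
  note const = set_integrable_const_lebesgue[OF S]
  show "set_integrable lebesgue S (\<lambda>x. (g x - c)\<^sup>2)"
    unfolding eq by (intro set_integral_add set_integral_diff set_integrable_mult_right assms const)
  have "(LINT x:S|lebesgue. (g x - c)\<^sup>2) = (LINT x:S|lebesgue. (g x)\<^sup>2) - 2 * c * (LINT x:S|lebesgue. g x) + measure lebesgue S * c\<^sup>2"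
    unfolding eq using assms const by (simp add: LINT_const_lebesgue[OF S])
  also have "\<dots> = measure lebesgue S * (var g S + (mean g S - c)\<^sup>2)"
  \<comment> \<open>On a null set \<open>mean\<close> is a division by 0, but both sides are then
    0.\<close>
  proof (cases "measure lebesgue S = 0")
    case True
    then have "emeasure lebesgue S = 0" using S by (simp add: emeasure_eq_ennreal_measure)
    then have "S \<in> null_sets lebesgue" using S by auto
    then have "(LINT x:S|lebesgue. u x) = 0" for u :: "'a \<Rightarrow> real"
      unfolding set_lebesgue_integral_def
      by (intro integral_eq_zero_AE) (use AE_not_in[of S lebesgue] in \<open>auto elim!: eventually_mono\<close>)
    then show ?thesis using True by simp
  next
    case False
    then show ?thesis by (simp add: var_def mean_def power2_eq_square field_simps)
  qed
  finally show "(LINT x:S|lebesgue. (g x - c)\<^sup>2) = measure lebesgue S * (var g S + (mean g S - c)\<^sup>2)" .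
qed

lemma var_nonneg:
  fixes g :: "'a::euclidean_space \<Rightarrow> real"
  assumes "set_integrable lebesgue S g" "set_integrable lebesgue S (\<lambda>x. (g x)\<^sup>2)"
    and S: "S \<in> sets lebesgue" "emeasure lebesgue S < \<infinity>" "measure lebesgue S \<noteq> 0"
  shows "0 \<le> var g S"
proof -
  have "0 \<le> (LINT x:S|lebesgue. (g x - mean g S)\<^sup>2)"
    unfolding set_lebesgue_integral_def by (intro Bochner_Integration.integral_nonneg) auto
  also have "\<dots> = measure lebesgue S * var g S"
    using set_integrable_diff_sq(2)[OF assms(1-4)] by simp
  finally have "0 \<le> measure lebesgue S * var g S" .
  moreover have "0 < measure lebesgue S" using S(3) by (simp add: zero_less_measure_iff)
  ultimately show ?thesis by (simp add: zero_le_mult_iff)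
qed

lemma chebyshev_mean:
  fixes g :: "'a::euclidean_space \<Rightarrow> real"
  assumes "set_integrable lebesgue S g" "set_integrable lebesgue S (\<lambda>x. (g x)\<^sup>2)"
    and S: "S \<in> sets lebesgue" "emeasure lebesgue S < \<infinity>" and t: "0 < t"
  shows "measure lebesgue {x\<in>S. t \<le> \<bar>g x - mean g S\<bar>} \<le> measure lebesgue S * var g S / t\<^sup>2"
proof -
  have "{x\<in>S. t \<le> \<bar>g x - mean g S\<bar>} = {x\<in>S. t\<^sup>2 \<le> (g x - mean g S)\<^sup>2}"
    using t by (auto simp: abs_le_square_iff[symmetric])
  then show ?thesis
    using integral_Markov_inequality'_measure[OF set_integrable_diff_sq(1)[OF assms(1-4)] S(1), of "mean g S" "t\<^sup>2"]
      set_integrable_diff_sq(2)[OF assms(1-4), of "mean g S"] t by simp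
qed

lemma set_nn_integral_eq:
  fixes u :: "'a \<Rightarrow> real"
  assumes "set_integrable M S u" "\<And>x. 0 \<le> u x"
  shows "(\<integral>\<^sup>+x\<in>S. ennreal (u x) \<partial>M) = ennreal (LINT x:S|M. u x)"
  using assms unfolding set_integrable_def set_lebesgue_integral_def nn_integral_set_ennreal
  by (subst nn_integral_eq_integral[symmetric]) (auto simp: mult.commute)

text \<open>The inner integral, with \<open>c = g y\<close>, gives the variance plus a squared
  deviation; integrating that deviation over \<open>y\<close> gives the variance a second
  time.\<close>

lemma double_osc_eq_var:
  fixes g :: "'a::euclidean_space \<Rightarrow> real"
  assumes g: "set_integrable lebesgue S g" "set_integrable lebesgue S (\<lambda>x. (g x)\<^sup>2)"
    and S: "S \<in> sets lebesgue" "emeasure lebesgue S < \<infinity>" "measure lebesgue S \<noteq> 0"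
  shows "double_osc g S 0 = ennreal (2 * (measure lebesgue S)\<^sup>2 * var g S)"
proof -
  note const = set_integrable_const_lebesgue[OF S(1,2)]
  have V: "0 \<le> var g S" by (rule var_nonneg[OF g S])
  have swap: "(mean g S - g y)\<^sup>2 = (g y - mean g S)\<^sup>2" for y by (rule power2_commute)
  have "double_osc g S 0 = (\<integral>\<^sup>+y\<in>S. ennreal (measure lebesgue S * (var g S + (g y - mean g S)\<^sup>2)) \<partial>lebesgue)"
    unfolding double_osc_def
    by (simp add: set_nn_integral_eq set_integrable_diff_sq[OF g S(1,2)] swap)
  also have "\<dots> = ennreal (LINT y:S|lebesgue. measure lebesgue S * (var g S + (g y - mean g S)\<^sup>2))"
    using V by (intro set_nn_integral_eq set_integrable_mult_right set_integral_add const set_integrable_diff_sq(1)[OF g S(1,2)]) auto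
  also have "(LINT y:S|lebesgue. measure lebesgue S * (var g S + (g y - mean g S)\<^sup>2))
    = measure lebesgue S * (measure lebesgue S * var g S + measure lebesgue S * var g S)"
    using set_integrable_diff_sq[OF g S(1,2), of "mean g S"] const by (simp add: LINT_const_lebesgue[OF S(1,2)])
  finally show ?thesis by (simp add: power2_eq_square algebra_simps)
qed

section \<open>From dyadic means to level sets\<close>

lemma corner_0 [simp]: "corner a l 0 (\<lambda>_. 0) = a"
  by (simp add: corner_def vec_eq_iff)

text \<open>The children have equal measure, so dyadic means form a martingale. This supplies the
  averaging hypotheses on \<open>m\<close> and \<open>q\<close> in the Bellman induction.\<close>

lemma mean_grid_Suc:
  fixes g :: "real^'n \<Rightarrow> real"
  assumes g: "set_integrable lebesgue (hcube a l) g" and l: "0 < l" and p: "p \<in> grid k"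
  shows "2 ^ CARD('n) * mean g (hcube (corner a l k p) (l / 2 ^ k))
    = (\<Sum>e\<in>grid 1. mean g (hcube (corner a l (Suc k) (child p e)) (l / 2 ^ Suc k)))"
proof -
  let ?h = "l / 2 ^ k"
  have h: "0 < ?h" using l by simp
  have gJ: "set_integrable lebesgue (hcube (corner a l k p) ?h) g"
    by (rule set_integrable_subset[OF g hcube_lebesgue hcube_grid_subset[OF l p]])
  have "(\<Sum>e\<in>grid 1. LINT x:hcube (corner a l (Suc k) (child p e)) (l / 2 ^ Suc k)|lebesgue. g x)
    = (LINT x:hcube (corner a l k p) ?h|lebesgue. g x)"
    using sum_integral_grid[OF gJ h, of 1] by (simp add: corner_child[unfolded One_nat_def] mult.commute)
  moreover have "mean g (hcube (corner a l (Suc k) (child p e)) (l / 2 ^ Suc k)) =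
      (LINT x:hcube (corner a l (Suc k) (child p e)) (l / 2 ^ Suc k)|lebesgue. g x) * (2 ^ CARD('n) / ?h ^ CARD('n))" for e
    using l unfolding mean_def by (subst measure_hcube) (auto simp: power_divide power_mult_distrib)
  ultimately show ?thesis
    using l unfolding mean_def[of g "hcube (corner a l k p) ?h"]
    by (subst measure_hcube) (auto simp: sum_distrib_right[symmetric] sum_distrib_left[symmetric] sum_divide_distrib[symmetric] mult.commute)
qed

text \<open>Where \<open>g\<close> deviates by more than \<open>2 * s\<close>, either the mean of
  the cell of generation \<open>k\<close> deviates by at least \<open>s\<close>, or \<open>g\<close>
  differs from that mean by at least \<open>s\<close>. The first set is counted by
  \<open>dyadic_deviation_count\<close> uniformly in \<open>k\<close>; the second becomes negligible
  for suitable \<open>k\<close>.\<close>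

lemma dyadic_tail_normalized:
  fixes g :: "real^'n \<Rightarrow> real"
  assumes [measurable]: "g \<in> borel_measurable lebesgue"
    and g: "set_integrable lebesgue (hcube a l) g" "set_integrable lebesgue (hcube a l) (\<lambda>x. (g x)\<^sup>2)"
    and l: "0 < l"
    and V: "\<And>k p. p \<in> grid k \<Longrightarrow> var g (hcube (corner a l k p) (l / 2 ^ k)) \<le> 1 / (16 * 2 ^ CARD('n))"
    and s: "0 < s"
  shows "measure lebesgue {x\<in>hcube a l. 2 * s < \<bar>g x - mean g (hcube a l)\<bar>} * (exp s + exp (- s) - 2)
    \<le> l ^ CARD('n) * (8 * var g (hcube a l))"
proof -
  let ?I = "hcube a l" and ?J = "\<lambda>k p. hcube (corner a l k p) (l / 2 ^ k)"
  define m where "m k p = mean g (?J k p)" for k p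
  define q where "q k p = mean (\<lambda>x. (g x)\<^sup>2) (?J k p)" for k p
  let ?c = "exp s + exp (- s) - 2" and ?A = "{x\<in>?I. 2 * s < \<bar>g x - mean g ?I\<bar>}"
  have gJ: "set_integrable lebesgue (?J k p) g" "set_integrable lebesgue (?J k p) (\<lambda>x. (g x)\<^sup>2)" if "p \<in> grid k" for k p
    using set_integrable_subset[OF g(1) hcube_lebesgue hcube_grid_subset[OF l that]]
      set_integrable_subset[OF g(2) hcube_lebesgue hcube_grid_subset[OF l that]] by auto
  have h: "0 < l / 2 ^ k" for k using l by simp
  have fin: "emeasure lebesgue (?J k p) < \<infinity>" and mJ: "measure lebesgue (?J k p) = (l / 2 ^ k) ^ CARD('n)" for k p
    using emeasure_hcube_finite[OF h] measure_hcube[OF less_imp_le[OF h]] by auto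
  have v0: "0 \<le> q k p - (m k p)\<^sup>2" if "p \<in> grid k" for k p
    using var_nonneg[OF gJ[OF that] hcube_lebesgue fin] mJ l unfolding m_def q_def var_def by simp
  have v1: "q k p - (m k p)\<^sup>2 \<le> 1 / (16 * 2 ^ CARD('n))" if "p \<in> grid k" for k p
    using V[OF that] unfolding m_def q_def var_def by simp
  have c: "0 < ?c"
  proof -
    have "?c = (exp (s / 2) - exp (- s / 2))\<^sup>2"
      by (simp add: power2_eq_square algebra_simps exp_add[symmetric])
    then show ?thesis using s by simp
  qed
  have "measure lebesgue ?A * ?c \<le> l ^ CARD('n) * (8 * var g ?I) + e" if e: "0 < e" for e
  proof -
    \<comment> \<open>The L1 error is chosen so that Markov's inequality at level \<open>s\<close>
      leaves measure \<open>e / ?c\<close>, which contributes \<open>e\<close> after multiplication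
      by \<open>?c\<close>.\<close>
    have "0 < e * s / ?c" using e s c by simp
    then obtain k where k: "(\<Sum>p\<in>grid k. LINT x:?J k p|lebesgue. \<bar>g x - mean g (?J k p)\<bar>) < e * s / ?c"
      using dyadic_L1_convergence[OF g(1) l] by blast
    let ?Bad = "{p\<in>grid k. s \<le> \<bar>m k p - m 0 (\<lambda>_. 0)\<bar>}"
    let ?E = "\<lambda>p. {x\<in>?J k p. s \<le> \<bar>g x - m k p\<bar>}"
    have Em: "?E p \<in> sets lebesgue" for p
    proof -
      have "?E p = ?J k p \<inter> {x\<in>space lebesgue. s \<le> \<bar>g x - m k p\<bar>}" by auto
      also have "\<dots> \<in> sets lebesgue" by measurable
      finally show ?thesis .
    qed
    have Efin: "emeasure lebesgue (?E p) < \<infinity>" for p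
      using le_less_trans[OF emeasure_mono[of "?E p" "?J k p" lebesgue] fin] by auto
    have finB: "finite ?Bad" by simp
    have sub: "?A \<subseteq> (\<Union>p\<in>?Bad. ?J k p) \<union> (\<Union>p\<in>grid k. ?E p)"
    proof
      fix x assume x: "x \<in> ?A"
      then obtain p where p: "p \<in> grid k" "x \<in> ?J k p" using hcube_grid_UN[OF l, of a k] by auto
      have "m 0 (\<lambda>_. 0) = mean g ?I" by (simp add: m_def)
      then have "s \<le> \<bar>m k p - m 0 (\<lambda>_. 0)\<bar> \<or> s \<le> \<bar>g x - m k p\<bar>" using x by auto
      then show "x \<in> (\<Union>p\<in>?Bad. ?J k p) \<union> (\<Union>p\<in>grid k. ?E p)" using p by auto
    qed
    have Jf: "?J k p \<in> fmeasurable lebesgue" for p using fin[of k p] by (intro fmeasurableI) auto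
    have Ef: "?E p \<in> fmeasurable lebesgue" for p using Efin[of p] Em[of p] by (intro fmeasurableI) auto
    have UJ: "(\<Union>p\<in>?Bad. ?J k p) \<in> fmeasurable lebesgue" using Jf finB by (intro fmeasurable.finite_UN) auto
    have UE: "(\<Union>p\<in>grid k. ?E p) \<in> fmeasurable lebesgue" using Ef by (intro fmeasurable.finite_UN) auto
    have Am: "?A \<in> sets lebesgue"
    proof -
      have "?A = ?I \<inter> {x\<in>space lebesgue. 2 * s < \<bar>g x - mean g ?I\<bar>}" by auto
      also have "\<dots> \<in> sets lebesgue" by measurable
      finally show ?thesis .
    qed
    have "measure lebesgue ?A \<le> measure lebesgue ((\<Union>p\<in>?Bad. ?J k p) \<union> (\<Union>p\<in>grid k. ?E p))"
      by (intro measure_mono_fmeasurable sub Am fmeasurable.Un UJ UE)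
    also have "\<dots> \<le> measure lebesgue (\<Union>p\<in>?Bad. ?J k p) + measure lebesgue (\<Union>p\<in>grid k. ?E p)"
      by (intro measure_Un_le) (use UJ UE in \<open>auto simp: fmeasurable_def\<close>)
    also have "\<dots> \<le> (\<Sum>p\<in>?Bad. measure lebesgue (?J k p)) + (\<Sum>p\<in>grid k. measure lebesgue (?E p))"
      by (intro add_mono measure_UNION_le) (use Em finB in auto)
    finally have S1: "measure lebesgue ?A \<le> (\<Sum>p\<in>?Bad. measure lebesgue (?J k p)) + (\<Sum>p\<in>grid k. measure lebesgue (?E p))" .
    have S2: "(\<Sum>p\<in>?Bad. measure lebesgue (?J k p)) = real (card ?Bad) * (l / 2 ^ k) ^ CARD('n)"
      by (simp add: mJ)
    have "(\<Sum>p\<in>grid k. measure lebesgue (?E p)) \<le> (\<Sum>p\<in>grid k. (LINT x:?J k p|lebesgue. \<bar>g x - m k p\<bar>) / s)"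
    proof (rule sum_mono)
      fix p :: "'n \<Rightarrow> nat" assume p: "p \<in> grid k"
      show "measure lebesgue (?E p) \<le> (LINT x:?J k p|lebesgue. \<bar>g x - m k p\<bar>) / s"
      proof (rule integral_Markov_inequality'_measure)
        show "set_integrable lebesgue (?J k p) (\<lambda>x. \<bar>g x - m k p\<bar>)"
          using fin by (intro set_integrable_abs set_integral_diff gJ(1)[OF p] set_integrable_const_lebesgue) auto
      qed (use s in auto)
    qed
    also have "\<dots> \<le> e / ?c"
    proof -
      have "(\<Sum>p\<in>grid k. LINT x:?J k p|lebesgue. \<bar>g x - m k p\<bar>) \<le> e / ?c * s"
        using k unfolding m_def by simp
      then show ?thesis unfolding sum_divide_distrib[symmetric] pos_divide_le_eq[OF s] .
    qed
    finally have S3: "(\<Sum>p\<in>grid k. measure lebesgue (?E p)) \<le> e / ?c" .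
    have "x * z \<le> y * z * w + e" if "x \<le> y * w + e / z" "0 < z" for x y z w :: real
      using that by (simp add: field_simps)
    note arith = this[OF _ c]
    have main: "measure lebesgue ?A * ?c \<le> real (card ?Bad) * ?c * (l / 2 ^ k) ^ CARD('n) + e"
      by (rule arith, rule order_trans[OF S1[unfolded S2]], rule add_left_mono, rule S3)
    have "real (card ?Bad) * ?c * (l / 2 ^ k) ^ CARD('n) \<le> (2 ^ (k * CARD('n)) * (8 * (q 0 (\<lambda>_. 0) - (m 0 (\<lambda>_. 0))\<^sup>2))) * (l / 2 ^ k) ^ CARD('n)"
    proof (intro mult_right_mono dyadic_deviation_count[where m=m and q=q])
      show "2 ^ CARD('n) * m k p = (\<Sum>e\<in>grid 1. m (Suc k) (child p e))" if "p \<in> grid k" for k p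
        unfolding m_def by (rule mean_grid_Suc[OF g(1) l that])
      show "2 ^ CARD('n) * q k p = (\<Sum>e\<in>grid 1. q (Suc k) (child p e))" if "p \<in> grid k" for k p
        unfolding q_def by (rule mean_grid_Suc[OF g(2) l that])
    qed (use v0 v1 s l in auto)
    also have "\<dots> = l ^ CARD('n) * (8 * var g ?I)"
      unfolding var_def m_def q_def by (simp add: power_divide power_mult)
    finally show ?thesis using main by linarith
  qed
  then show ?thesis by (rule field_le_epsilon)
qed

lemma mean_cmult: "mean (\<lambda>x. c * g x) S = c * mean g S"
  by (simp add: mean_def)

lemma var_cmult: "var (\<lambda>x. c * g x) S = c\<^sup>2 * var g S"
  by (simp add: var_def mean_cmult power_mult_distrib right_diff_distrib)

text \<open>Scaling by \<open>c\<close> turns the variance bound \<open>\<eta>\<close> into the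
  normalised \<open>1 / (16 * 2 ^ CARD('n))\<close>; the threshold \<open>t\<close> becomes
  \<open>2 * s\<close> with \<open>s = c * t / 2\<close>.\<close>

lemma dyadic_tail:
  fixes g :: "real^'n \<Rightarrow> real" and \<eta> :: real
  defines "c \<equiv> 1 / (4 * sqrt (\<eta> * 2 ^ CARD('n)))"
  assumes m: "g \<in> borel_measurable lebesgue"
    and g: "set_integrable lebesgue (hcube a l) g" "set_integrable lebesgue (hcube a l) (\<lambda>x. (g x)\<^sup>2)"
    and l: "0 < l" and \<eta>: "0 < \<eta>"
    and V: "\<And>k p. p \<in> grid k \<Longrightarrow> var g (hcube (corner a l k p) (l / 2 ^ k)) \<le> \<eta>"
    and t: "0 < t"
  shows "measure lebesgue {x\<in>hcube a l. t < \<bar>g x - mean g (hcube a l)\<bar>} * (exp (c * t / 2) + exp (- (c * t / 2)) - 2)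
    \<le> l ^ CARD('n) * (8 * c\<^sup>2 * var g (hcube a l))"
proof -
  have c: "0 < c" using \<eta> by (simp add: c_def)
  have c2: "c\<^sup>2 * \<eta> = 1 / (16 * 2 ^ CARD('n))"
    using \<eta> by (simp add: c_def power_divide power_mult_distrib real_sqrt_pow2)
  have "{x\<in>hcube a l. t < \<bar>g x - mean g (hcube a l)\<bar>} = {x\<in>hcube a l. 2 * (c * t / 2) < \<bar>c * g x - mean (\<lambda>x. c * g x) (hcube a l)\<bar>}"
    using c by (simp add: mean_cmult right_diff_distrib[symmetric] abs_mult)
  moreover have "measure lebesgue {x\<in>hcube a l. 2 * (c * t / 2) < \<bar>c * g x - mean (\<lambda>x. c * g x) (hcube a l)\<bar>}
      * (exp (c * t / 2) + exp (- (c * t / 2)) - 2) \<le> l ^ CARD('n) * (8 * var (\<lambda>x. c * g x) (hcube a l))"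
  proof (rule dyadic_tail_normalized)
    show "var (\<lambda>x. c * g x) (hcube (corner a l k p) (l / 2 ^ k)) \<le> 1 / (16 * 2 ^ CARD('n))" if "p \<in> grid k" for k p
      unfolding var_cmult c2[symmetric] using V[OF that] by (intro mult_left_mono) auto
  qed (use m g l c t in \<open>auto simp: power_mult_distrib\<close>)
  ultimately show ?thesis by (simp add: var_cmult mult_ac)
qed

section \<open>Application to the space Q\<close>

text \<open>Membership in \<open>Q_space\<close> gives only measurability and a finite double
  integral. Some \<open>y\<close> in \<open>S\<close> then has a finite inner integral, so
  \<open>g - g y\<close> is square integrable there; this gives meaning to the averages.\<close>

lemma square_integrable_of_double_osc:
  fixes g :: "'a::euclidean_space \<Rightarrow> real"
  assumes m [measurable]: "g \<in> borel_measurable lebesgue" and S [measurable]: "S \<in> sets lebesgue"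
    and fin: "emeasure lebesgue S < \<infinity>" and pos: "emeasure lebesgue S \<noteq> 0"
    and D: "double_osc g S 0 < \<infinity>"
  shows "set_integrable lebesgue S g" "set_integrable lebesgue S (\<lambda>x. (g x)\<^sup>2)"
proof -
  let ?i = "\<lambda>y. \<integral>\<^sup>+x\<in>S. ennreal ((g x - g y)\<^sup>2) \<partial>lebesgue"
  have im [measurable]: "?i \<in> borel_measurable lebesgue"
    using lebesgue.borel_measurable_nn_integral[of "\<lambda>y x. ennreal ((g x - g y)\<^sup>2) * indicator S x" lebesgue] by simp
  have "(\<integral>\<^sup>+y. ?i y * indicator S y \<partial>lebesgue) \<noteq> \<infinity>"
    using D by (simp add: double_osc_def less_top)
  then have ae: "AE y in lebesgue. ?i y * indicator S y \<noteq> \<infinity>"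
    by (intro nn_integral_PInf_AE) auto
  have "\<exists>y\<in>S. ?i y \<noteq> \<infinity>"
  proof (rule ccontr)
    assume "\<not> ?thesis"
    then have "AE y in lebesgue. y \<notin> S" using ae by (auto elim!: eventually_mono)
    then have "emeasure lebesgue S = 0" using AE_iff_measurable[OF S, of "\<lambda>y. y \<notin> S"] by simp
    with pos show False by simp
  qed
  then obtain y where y: "?i y < \<infinity>" by (auto simp: less_top)
  let ?u = "\<lambda>x. g x - g y"
  have u2: "set_integrable lebesgue S (\<lambda>x. (?u x)\<^sup>2)"
    unfolding set_integrable_def
  proof (rule integrableI_bounded)
    have "(\<integral>\<^sup>+x. ennreal (norm (indicator S x *\<^sub>R (?u x)\<^sup>2)) \<partial>lebesgue) = ?i y"
      by (intro nn_integral_cong) (auto simp: indicator_def)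
    then show "(\<integral>\<^sup>+x. ennreal (norm (indicator S x *\<^sub>R (?u x)\<^sup>2)) \<partial>lebesgue) < \<infinity>" using y by simp
  qed simp
  note const = set_integrable_const_lebesgue[OF S fin]
  have sm: "set_borel_measurable lebesgue S ?u" unfolding set_borel_measurable_def by simp
  have "\<bar>t\<bar> \<le> 1 + t\<^sup>2" for t :: real
    using zero_le_power2[of "\<bar>t\<bar> - 1"] by (simp add: power2_diff)
  then have "norm (?u x) \<le> norm (1 + (?u x)\<^sup>2)" for x by simp
  then have u: "set_integrable lebesgue S ?u"
    by (intro set_integrable_bound[OF set_integral_add(1)[OF const[of 1] u2] sm] AE_I2) blast
  have eq: "g = (\<lambda>x. ?u x + g y)" "(\<lambda>x. (g x)\<^sup>2) = (\<lambda>x. (?u x)\<^sup>2 + 2 * g y * ?u x + (g y)\<^sup>2)"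
    by (auto simp: fun_eq_iff power2_eq_square algebra_simps)
  show "set_integrable lebesgue S g" by (subst eq(1)) (intro set_integral_add u const)
  show "set_integrable lebesgue S (\<lambda>x. (g x)\<^sup>2)"
    by (subst eq(2)) (intro set_integral_add set_integrable_mult_right u u2 const)
qed

lemma double_osc_mono:
  assumes "\<And>x y. norm (g x - g y) \<le> norm (f x - f y)"
  shows "double_osc g S r \<le> double_osc f S r"
  unfolding double_osc_def
  by (intro nn_integral_mono mult_right_mono ennreal_leI power_mono assms) auto

lemma ennreal_sqrt_le:
  assumes "ennreal_sqrt x \<le> ennreal N" "0 \<le> N"
  shows "x \<le> ennreal (N\<^sup>2)"
proof -
  have x: "x \<noteq> \<infinity>" using assms by (auto simp: ennreal_sqrt_def top_unique)
  then have "sqrt (enn2real x) \<le> N" using assms by (simp add: ennreal_sqrt_def)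
  then have "enn2real x \<le> N\<^sup>2" by (simp add: sqrt_le_D)
  then have "ennreal (enn2real x) \<le> ennreal (N\<^sup>2)" by (rule ennreal_leI)
  moreover have "ennreal (enn2real x) = x" using x by (simp add: less_top)
  ultimately show ?thesis by (simp only:)
qed

lemma Q_norm_cube_bound:
  fixes f :: "real^'n \<Rightarrow> complex"
  assumes f: "f \<in> Q_space \<alpha> \<beta>" and l: "0 < l"
  shows "ennreal (l powr (2 * (\<alpha> + \<beta> - 1) - real CARD('n))) *
      (\<integral>\<^sup>+y\<in>hcube a l. (\<integral>\<^sup>+x\<in>hcube a l. ennreal ((cmod (f x - f y))\<^sup>2 /
         norm (x - y) powr (real CARD('n) + 2 * (\<alpha> - \<beta> + 1))) \<partial>lebesgue) \<partial>lebesgue)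
    \<le> ennreal ((Q_norm \<alpha> \<beta> f)\<^sup>2)"
proof -
  let ?k = "\<lambda>x y. ennreal ((cmod (f x - f y))\<^sup>2 / norm (x - y) powr (real CARD('n) + 2 * (\<alpha> - \<beta> + 1)))"
  let ?w = "ennreal (l powr (2 * (\<alpha> + \<beta> - 1) - real CARD('n)))"
  have "Q_enorm \<alpha> \<beta> f < \<infinity>" using f by (simp add: Q_space_def)
  then have N: "Q_enorm \<alpha> \<beta> f = ennreal (Q_norm \<alpha> \<beta> f)" by (simp add: Q_norm_def)
  have "ennreal_sqrt (?w * (\<integral>\<^sup>+y\<in>cube a l. (\<integral>\<^sup>+x\<in>cube a l. ?k x y \<partial>lebesgue) \<partial>lebesgue)) \<le> Q_enorm \<alpha> \<beta> f"
    unfolding Q_enorm_def by (rule SUP_upper2[of "(a, l)"]) (use l in auto)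
  then have *: "?w * (\<integral>\<^sup>+y\<in>cube a l. (\<integral>\<^sup>+x\<in>cube a l. ?k x y \<partial>lebesgue) \<partial>lebesgue) \<le> ennreal ((Q_norm \<alpha> \<beta> f)\<^sup>2)"
    unfolding N by (rule ennreal_sqrt_le) (simp add: Q_norm_def)
  have "(\<integral>\<^sup>+y\<in>hcube a l. (\<integral>\<^sup>+x\<in>hcube a l. ?k x y \<partial>lebesgue) \<partial>lebesgue) \<le> (\<integral>\<^sup>+y\<in>cube a l. (\<integral>\<^sup>+x\<in>cube a l. ?k x y \<partial>lebesgue) \<partial>lebesgue)"
    by (rule order_trans[OF nn_set_integral_set_mono[OF hcube_subset_cube]])
      (intro nn_integral_mono mult_right_mono nn_set_integral_set_mono[OF hcube_subset_cube], auto)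
  then show ?thesis by (intro order_trans[OF _ *] mult_left_mono) auto
qed

text \<open>The constant produced by \<open>sum_double_osc_le\<close>; the type argument carries the
  dimension.\<close>

definition osc_const :: "'n itself \<Rightarrow> real \<Rightarrow> real" where
  "osc_const _ \<theta> = 8 * (8 * real CARD('n)) powr \<bar>\<theta>\<bar> * (8 * real CARD('n) + 1)"

lemma osc_const_pos: "0 < osc_const TYPE('n::finite) \<theta>"
  by (simp add: osc_const_def)

text \<open>The prefactor \<open>l powr (4 * \<beta> - 4)\<close> is what turns the power of
  \<open>l\<close> in \<open>sum_double_osc_le\<close> into that of the norm: \<open>(4 * \<beta> -
  4) + (2 * (\<alpha> - \<beta> + 1) - n) = 2 * (\<alpha> + \<beta> - 1) - n\<close>.\<close>

lemma Q_norm_osc_sum: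
  fixes f :: "real^'n \<Rightarrow> complex" and \<alpha> \<beta> :: real
  defines "\<theta> \<equiv> real CARD('n) + 2 * (\<alpha> - \<beta> + 1)"
  assumes f: "f \<in> Q_space \<alpha> \<beta>" and l: "0 < l"
  shows "ennreal (l powr (4 * \<beta> - 4)) * (\<Sum>k. ennreal (2 powr ((2 * (\<alpha> - \<beta> + 1) - real CARD('n)) * real k)) *
      (\<Sum>p\<in>grid k. double_osc f (hcube (corner a l k p) (l / 2 ^ k)) 0 / ennreal (((l / 2 ^ k) ^ CARD('n))\<^sup>2)))
    \<le> ennreal (osc_const TYPE('n) \<theta> * (Q_norm \<alpha> \<beta> f)\<^sup>2)"
proof -
  have m: "f \<in> borel_measurable lebesgue" using f by (simp add: Q_space_def)
  have e: "\<theta> - 2 * real CARD('n) = 2 * (\<alpha> - \<beta> + 1) - real CARD('n)" by (simp add: \<theta>_def)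
  let ?E = "\<integral>\<^sup>+y\<in>hcube a l. (\<integral>\<^sup>+x\<in>hcube a l. ennreal ((cmod (f x - f y))\<^sup>2 / norm (x - y) powr \<theta>) \<partial>lebesgue) \<partial>lebesgue"
  have "ennreal (l powr (4 * \<beta> - 4)) * (\<Sum>k. ennreal (2 powr ((2 * (\<alpha> - \<beta> + 1) - real CARD('n)) * real k)) *
      (\<Sum>p\<in>grid k. double_osc f (hcube (corner a l k p) (l / 2 ^ k)) 0 / ennreal (((l / 2 ^ k) ^ CARD('n))\<^sup>2)))
    \<le> ennreal (l powr (4 * \<beta> - 4)) * (ennreal (osc_const TYPE('n) \<theta>) * (ennreal (l powr (2 * (\<alpha> - \<beta> + 1) - real CARD('n))) * ?E))"
    using sum_double_osc_le[OF m l, of \<theta> a] unfolding e osc_const_def by (intro mult_left_mono) auto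
  also have "\<dots> = ennreal (osc_const TYPE('n) \<theta>) * (ennreal (l powr (2 * (\<alpha> + \<beta> - 1) - real CARD('n))) * ?E)"
  proof -
    have "l powr (2 * (\<alpha> + \<beta> - 1) - real CARD('n)) = l powr (4 * \<beta> - 4) * l powr (2 * (\<alpha> - \<beta> + 1) - real CARD('n))"
      unfolding powr_add[symmetric] by (intro arg_cong[where f="\<lambda>e. l powr e"]) simp
    then show ?thesis by (simp add: ennreal_mult mult_ac)
  qed
  also have "\<dots> \<le> ennreal (osc_const TYPE('n) \<theta>) * ennreal ((Q_norm \<alpha> \<beta> f)\<^sup>2)"
    using Q_norm_cube_bound[OF f l, of a] unfolding \<theta>_def by (intro mult_left_mono) auto
  also have "\<dots> = ennreal (osc_const TYPE('n) \<theta> * (Q_norm \<alpha> \<beta> f)\<^sup>2)"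
    using osc_const_pos[of \<theta>, where 'n='n] by (simp add: ennreal_mult)
  finally show ?thesis .
qed

text \<open>The term \<open>k = 0\<close> of the series. It controls the variance on one cube, and
  through the power of \<open>l\<close> it creates the split by edge length.\<close>

lemma Q_norm_osc_cube:
  fixes f :: "real^'n \<Rightarrow> complex" and \<alpha> \<beta> :: real
  assumes f: "f \<in> Q_space \<alpha> \<beta>" and l: "0 < l"
  shows "ennreal (l powr (4 * \<beta> - 4)) * (double_osc f (hcube a l) 0 / ennreal ((l ^ CARD('n))\<^sup>2))
    \<le> ennreal (osc_const TYPE('n) (real CARD('n) + 2 * (\<alpha> - \<beta> + 1)) * (Q_norm \<alpha> \<beta> f)\<^sup>2)"
proof -
  let ?F = "\<lambda>k. ennreal (2 powr ((2 * (\<alpha> - \<beta> + 1) - real CARD('n)) * real k)) *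
      (\<Sum>p\<in>grid k. double_osc f (hcube (corner a l k p) (l / 2 ^ k)) 0 / ennreal (((l / 2 ^ k) ^ CARD('n))\<^sup>2))"
  have "?F 0 \<le> (\<Sum>k. ?F k)" using sum_le_suminf[of ?F "{0}"] by simp
  then have "ennreal (l powr (4 * \<beta> - 4)) * ?F 0 \<le> ennreal (l powr (4 * \<beta> - 4)) * (\<Sum>k. ?F k)"
    by (intro mult_left_mono) auto
  then show ?thesis
    using Q_norm_osc_sum[OF f l, of a] by (simp add: grid_0)
qed

lemma double_osc_finite:
  fixes f :: "real^'n \<Rightarrow> complex"
  assumes f: "f \<in> Q_space \<alpha> \<beta>" and l: "0 < l"
  shows "double_osc f (hcube a l) 0 < \<infinity>"
proof (rule ccontr)
  assume "\<not> ?thesis"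
  then have "double_osc f (hcube a l) 0 = top" by (simp add: not_less top_unique)
  then have "ennreal (l powr (4 * \<beta> - 4)) * (double_osc f (hcube a l) 0 / ennreal ((l ^ CARD('n))\<^sup>2)) = top"
    using l by (simp add: ennreal_top_divide ennreal_mult_top)
  with Q_norm_osc_cube[OF f l, of a] show False by (simp add: top_unique)
qed

text \<open>The exponential argument is for real functions. A set of both parts lets one tail
  hypothesis cover them together.\<close>

definition parts :: "('a \<Rightarrow> complex) \<Rightarrow> ('a \<Rightarrow> real) set" where
  "parts f = {\<lambda>x. Re (f x), \<lambda>x. Im (f x)}"

lemma parts_Q_space:
  fixes f :: "real^'n \<Rightarrow> complex"
  assumes f: "f \<in> Q_space \<alpha> \<beta>" and l: "0 < l" and g: "g \<in> parts f"
  shows "g \<in> borel_measurable lebesgue" "set_integrable lebesgue (hcube a l) g"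
    "set_integrable lebesgue (hcube a l) (\<lambda>x. (g x)\<^sup>2)"
    "ennreal (var g (hcube a l)) \<le> double_osc f (hcube a l) 0 / ennreal ((l ^ CARD('n))\<^sup>2)"
    "0 \<le> var g (hcube a l)"
proof -
  have fm [measurable]: "f \<in> borel_measurable lebesgue" using f by (simp add: Q_space_def)
  show m: "g \<in> borel_measurable lebesgue" using g unfolding parts_def by auto
  have "norm (g x - g y) \<le> norm (f x - f y)" for x y
    using g abs_Re_le_cmod[of "f x - f y"] abs_Im_le_cmod[of "f x - f y"] by (auto simp: parts_def)
  then have le: "double_osc g (hcube a l) 0 \<le> double_osc f (hcube a l) 0" by (rule double_osc_mono)
  have fin: "emeasure lebesgue (hcube a l) < \<infinity>" and ms: "measure lebesgue (hcube a l) = l ^ CARD('n)"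
    using l emeasure_hcube_finite[OF l] measure_hcube[of l a] by auto
  have "emeasure lebesgue (hcube a l) \<noteq> 0" using l by (simp add: emeasure_hcube)
  note sq = square_integrable_of_double_osc[OF m hcube_lebesgue fin this le_less_trans[OF le double_osc_finite[OF f l]]]
  show "set_integrable lebesgue (hcube a l) g" "set_integrable lebesgue (hcube a l) (\<lambda>x. (g x)\<^sup>2)" by (rule sq)+
  have ms0: "measure lebesgue (hcube a l) \<noteq> 0" using ms l by simp
  show v: "0 \<le> var g (hcube a l)" using var_nonneg[OF sq hcube_lebesgue fin ms0] .
  have "ennreal (var g (hcube a l)) \<le> ennreal (2 * var g (hcube a l))" using v by (intro ennreal_leI) simp
  also have "\<dots> = double_osc g (hcube a l) 0 / ennreal ((l ^ CARD('n))\<^sup>2)"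
    unfolding double_osc_eq_var[OF sq hcube_lebesgue fin ms0] ms using l v by (subst divide_ennreal) auto
  also have "\<dots> \<le> double_osc f (hcube a l) 0 / ennreal ((l ^ CARD('n))\<^sup>2)"
    by (intro divide_right_mono_ennreal le)
  finally show "ennreal (var g (hcube a l)) \<le> double_osc f (hcube a l) 0 / ennreal ((l ^ CARD('n))\<^sup>2)" .
qed

section \<open>From level sets to the dyadic sum\<close>

lemma LINT_cube_hcube:
  fixes g :: "real^'n \<Rightarrow> real"
  assumes "g \<in> borel_measurable lebesgue"
  shows "(LINT x:cube a l|lebesgue. g x) = (LINT x:hcube a l|lebesgue. g x)"
  unfolding set_lebesgue_integral_def
  by (intro integral_cong_AE) (use assms AE_cube_hcube[of a l] in \<open>auto elim!: eventually_mono simp: indicator_def\<close>)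

lemma average_parts:
  fixes f :: "real^'n \<Rightarrow> complex"
  assumes f: "f \<in> Q_space \<alpha> \<beta>" and l: "0 < l"
  shows "Re (average f (cube a l)) = mean (\<lambda>x. Re (f x)) (hcube a l)"
    "Im (average f (cube a l)) = mean (\<lambda>x. Im (f x)) (hcube a l)"
proof -
  have fm [measurable]: "f \<in> borel_measurable lebesgue" using f by (simp add: Q_space_def)
  have ri: "set_integrable lebesgue (cube a l) (\<lambda>x. Re (f x))" "set_integrable lebesgue (cube a l) (\<lambda>x. Im (f x))"
  proof -
    have "set_integrable lebesgue (cube a l) g" if "g \<in> parts f" for g
      using parts_Q_space(2)[OF f l that, of a] parts_Q_space(1)[OF f l that]
      unfolding set_integrable_def
      by (subst integrable_cong_AE[of _ _ "\<lambda>x. indicator (hcube a l) x *\<^sub>R g x"])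
        (use AE_cube_hcube[of a l] in \<open>auto elim!: eventually_mono simp: indicator_def\<close>)
    then show "set_integrable lebesgue (cube a l) (\<lambda>x. Re (f x))" "set_integrable lebesgue (cube a l) (\<lambda>x. Im (f x))"
      by (auto simp: parts_def)
  qed
  have fi: "integrable lebesgue (\<lambda>x. indicator (cube a l) x *\<^sub>R f x)"
  proof -
    have "(\<lambda>x. indicator (cube a l) x *\<^sub>R f x) =
        (\<lambda>x. complex_of_real (indicator (cube a l) x *\<^sub>R Re (f x)) + \<i> * complex_of_real (indicator (cube a l) x *\<^sub>R Im (f x)))"
      by (simp add: fun_eq_iff complex_eq_iff)
    then show ?thesis
      using ri unfolding set_integrable_def
      by (auto simp del: of_real_mult real_scaleR_def intro!: Bochner_Integration.integrable_add integrable_mult_right integrable_of_real)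
  qed
  show "Re (average f (cube a l)) = mean (\<lambda>x. Re (f x)) (hcube a l)"
    using integral_Re[OF fi] l LINT_cube_hcube[of "\<lambda>x. Re (f x)" a l]
    by (simp add: average_def mean_def set_lebesgue_integral_def measure_cube measure_hcube divide_inverse mult.commute)
  show "Im (average f (cube a l)) = mean (\<lambda>x. Im (f x)) (hcube a l)"
    using integral_Im[OF fi] l LINT_cube_hcube[of "\<lambda>x. Im (f x)" a l]
    by (simp add: average_def mean_def set_lebesgue_integral_def measure_cube measure_hcube divide_inverse mult.commute)
qed

text \<open>A deviation above \<open>t\<close> forces one above \<open>t / 2\<close> in the real or
  the imaginary part, off the null set of faces. The two parts account for the factor 2 in front of
  \<open>\<kappa>\<close>.\<close>

lemma dist_fun_le:
  fixes f :: "real^'n \<Rightarrow> complex"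
  assumes f: "f \<in> Q_space \<alpha> \<beta>" and l: "0 < l" and \<kappa>: "0 \<le> \<kappa>"
    and tail: "\<And>g. g \<in> parts f \<Longrightarrow>
      measure lebesgue {x\<in>hcube a l. t / 2 < \<bar>g x - mean g (hcube a l)\<bar>} \<le> l ^ CARD('n) * (\<kappa> * var g (hcube a l))"
  shows "dist_fun f (cube a l) t / emeasure lebesgue (cube a l)
    \<le> ennreal (2 * \<kappa>) * (double_osc f (hcube a l) 0 / ennreal ((l ^ CARD('n))\<^sup>2))"
proof -
  let ?S = "\<lambda>g. {x\<in>hcube a l. t / 2 < \<bar>g x - mean g (hcube a l)\<bar>}"
  let ?g = "\<lambda>x. Re (f x)" and ?h = "\<lambda>x. Im (f x)"
  let ?V = "double_osc f (hcube a l) 0 / ennreal ((l ^ CARD('n))\<^sup>2)"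
  have gh: "?g \<in> parts f" "?h \<in> parts f" by (auto simp: parts_def)
  have Sm: "?S g \<in> sets lebesgue" if "g \<in> parts f" for g
  proof -
    have [measurable]: "g \<in> borel_measurable lebesgue" using parts_Q_space(1)[OF f l that] .
    have "?S g = hcube a l \<inter> {x\<in>space lebesgue. t / 2 < \<bar>g x - mean g (hcube a l)\<bar>}" by auto
    also have "\<dots> \<in> sets lebesgue" by measurable
    finally show ?thesis .
  qed
  have each: "emeasure lebesgue (?S g) \<le> ennreal (l ^ CARD('n)) * (ennreal \<kappa> * ?V)" if g: "g \<in> parts f" for g
  proof -
    have "emeasure lebesgue (?S g) \<le> emeasure lebesgue (hcube a l)" by (intro emeasure_mono) auto
    then have "emeasure lebesgue (?S g) < \<infinity>" using emeasure_hcube_finite[OF l, of a] by (rule le_less_trans)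
    then have "emeasure lebesgue (?S g) = ennreal (measure lebesgue (?S g))" by (simp add: emeasure_eq_ennreal_measure)
    also have "\<dots> \<le> ennreal (l ^ CARD('n) * (\<kappa> * var g (hcube a l)))" using tail[OF g] by (rule ennreal_leI)
    also have "\<dots> = ennreal (l ^ CARD('n)) * (ennreal \<kappa> * ennreal (var g (hcube a l)))"
      using l \<kappa> parts_Q_space(5)[OF f l g] by (simp add: ennreal_mult)
    also have "\<dots> \<le> ennreal (l ^ CARD('n)) * (ennreal \<kappa> * ?V)"
      by (intro mult_left_mono parts_Q_space(4)[OF f l g]) auto
    finally show ?thesis .
  qed
  have "{x\<in>cube a l. t < cmod (f x - average f (cube a l))} \<subseteq> (cube a l - hcube a l) \<union> (?S ?g \<union> ?S ?h)"
  proof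
    fix x assume x: "x \<in> {x\<in>cube a l. t < cmod (f x - average f (cube a l))}"
    then have "t < \<bar>Re (f x) - mean ?g (hcube a l)\<bar> + \<bar>Im (f x) - mean ?h (hcube a l)\<bar>"
      using cmod_le[of "f x - average f (cube a l)"] by (simp add: average_parts[OF f l])
    then have "t / 2 < \<bar>Re (f x) - mean ?g (hcube a l)\<bar> \<or> t / 2 < \<bar>Im (f x) - mean ?h (hcube a l)\<bar>" by linarith
    then show "x \<in> (cube a l - hcube a l) \<union> (?S ?g \<union> ?S ?h)" using x by auto
  qed
  then have "dist_fun f (cube a l) t \<le> emeasure lebesgue ((cube a l - hcube a l) \<union> (?S ?g \<union> ?S ?h))"
    unfolding dist_fun_def by (intro emeasure_mono) (use Sm gh in auto)
  also have "\<dots> \<le> emeasure lebesgue (cube a l - hcube a l) + emeasure lebesgue (?S ?g \<union> ?S ?h)"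
    by (intro emeasure_subadditive sets.Un Sm gh) auto
  also have "\<dots> \<le> 0 + (emeasure lebesgue (?S ?g) + emeasure lebesgue (?S ?h))"
    using cube_minus_hcube_null[of a l] by (intro add_mono emeasure_subadditive Sm gh) auto
  also have "\<dots> \<le> 0 + (ennreal (l ^ CARD('n)) * (ennreal \<kappa> * ?V) + ennreal (l ^ CARD('n)) * (ennreal \<kappa> * ?V))"
    by (intro add_mono each gh) auto
  also have "\<dots> = ennreal (2 * \<kappa>) * ?V * ennreal (l ^ CARD('n))"
    using \<kappa> by (simp add: ennreal_mult mult_2[symmetric] mult_ac)
  finally have "dist_fun f (cube a l) t / ennreal (l ^ CARD('n)) \<le> ennreal (2 * \<kappa>) * ?V * ennreal (l ^ CARD('n)) / ennreal (l ^ CARD('n))"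
    by (rule divide_right_mono_ennreal)
  also have "\<dots> = ennreal (2 * \<kappa>) * ?V"
    using l by (intro ennreal_mult_divide_eq) auto
  finally show ?thesis using l by (simp add: emeasure_cube)
qed

text \<open>Reduces the theorem to finding \<open>\<kappa>\<close>: the tails stay proportional to
  the variance, so the series is controlled by \<open>Q_norm_osc_sum\<close>.\<close>

lemma dyadic_dist_sum_le:
  fixes f :: "real^'n \<Rightarrow> complex"
  assumes f: "f \<in> Q_space \<alpha> \<beta>" and l: "0 < l" and \<kappa>: "0 \<le> \<kappa>"
    and tail: "\<And>g k p. g \<in> parts f \<Longrightarrow> p \<in> grid k \<Longrightarrow>
      measure lebesgue {x\<in>hcube (corner a l k p) (l / 2 ^ k). t / 2 < \<bar>g x - mean g (hcube (corner a l k p) (l / 2 ^ k))\<bar>}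
        \<le> (l / 2 ^ k) ^ CARD('n) * (\<kappa> * var g (hcube (corner a l k p) (l / 2 ^ k)))"
  shows "dyadic_dist_sum \<alpha> \<beta> f a l t
    \<le> ennreal (2 * \<kappa> * (osc_const TYPE('n) (real CARD('n) + 2 * (\<alpha> - \<beta> + 1)) * (Q_norm \<alpha> \<beta> f)\<^sup>2))"
proof -
  let ?w = "\<lambda>k::nat. ennreal (2 powr ((2 * (\<alpha> - \<beta> + 1) - real CARD('n)) * real k))"
  let ?V = "\<lambda>k p. double_osc f (hcube (corner a l k p) (l / 2 ^ k)) 0 / ennreal (((l / 2 ^ k) ^ CARD('n))\<^sup>2)"
  have "?w k * (\<Sum>J\<in>dyadic_subcubes k a l. dist_fun f J t / emeasure lebesgue J) \<le> ennreal (2 * \<kappa>) * (?w k * (\<Sum>p\<in>grid k. ?V k p))" for k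
  proof -
    have "(\<Sum>J\<in>dyadic_subcubes k a l. dist_fun f J t / emeasure lebesgue J)
      \<le> (\<Sum>p\<in>grid k. dist_fun f (cube (corner a l k p) (l / 2 ^ k)) t / emeasure lebesgue (cube (corner a l k p) (l / 2 ^ k)))"
      by (rule sum_dyadic_subcubes_le)
    also have "\<dots> \<le> (\<Sum>p\<in>grid k. ennreal (2 * \<kappa>) * ?V k p)"
      using l by (intro sum_mono dist_fun_le[OF f _ \<kappa>] tail) auto
    finally have "?w k * (\<Sum>J\<in>dyadic_subcubes k a l. dist_fun f J t / emeasure lebesgue J) \<le> ?w k * (ennreal (2 * \<kappa>) * (\<Sum>p\<in>grid k. ?V k p))"
      unfolding sum_distrib_left[symmetric] by (rule mult_left_mono) auto
    then show ?thesis by (simp only: mult_ac)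
  qed
  then have "(\<Sum>k. ?w k * (\<Sum>J\<in>dyadic_subcubes k a l. dist_fun f J t / emeasure lebesgue J))
      \<le> (\<Sum>k. ennreal (2 * \<kappa>) * (?w k * (\<Sum>p\<in>grid k. ?V k p)))"
    by (intro suminf_le) auto
  also have "\<dots> = ennreal (2 * \<kappa>) * (\<Sum>k. ?w k * (\<Sum>p\<in>grid k. ?V k p))" by simp
  finally have "dyadic_dist_sum \<alpha> \<beta> f a l t \<le> ennreal (l powr (4 * \<beta> - 4)) * (ennreal (2 * \<kappa>) * (\<Sum>k. ?w k * (\<Sum>p\<in>grid k. ?V k p)))"
    unfolding dyadic_dist_sum_def by (intro mult_left_mono) auto
  also have "\<dots> = ennreal (2 * \<kappa>) * (ennreal (l powr (4 * \<beta> - 4)) * (\<Sum>k. ?w k * (\<Sum>p\<in>grid k. ?V k p)))"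
    by (simp only: mult_ac)
  also have "\<dots> \<le> ennreal (2 * \<kappa>) * ennreal (osc_const TYPE('n) (real CARD('n) + 2 * (\<alpha> - \<beta> + 1)) * (Q_norm \<alpha> \<beta> f)\<^sup>2)"
    by (intro mult_left_mono Q_norm_osc_sum[OF f l]) auto
  also have "\<dots> = ennreal (2 * \<kappa> * (osc_const TYPE('n) (real CARD('n) + 2 * (\<alpha> - \<beta> + 1)) * (Q_norm \<alpha> \<beta> f)\<^sup>2))"
    using \<kappa> osc_const_pos[where 'n='n] by (subst ennreal_mult) (auto simp: less_imp_le)
  finally show ?thesis .
qed

text \<open>The left factor is that of \<open>exp z * (1 - exp (- z))\<^sup>2\<close>, frozen at
  \<open>z0\<close>. Away from 0 the weight \<open>2 * (cosh z - 1)\<close> is thus comparable with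
  \<open>exp z\<close>.\<close>

lemma exp_sum_minus_2_ge:
  fixes z z0 :: real
  assumes "0 < z0" "z0 \<le> z"
  shows "exp z * (1 - exp (- z0))\<^sup>2 \<le> exp z + exp (- z) - 2"
proof -
  have "exp z + exp (- z) - 2 = exp z * (1 - exp (- z))\<^sup>2"
    by (simp add: power2_eq_square algebra_simps exp_add[symmetric] mult_exp_exp)
  moreover have "(1 - exp (- z0))\<^sup>2 \<le> (1 - exp (- z))\<^sup>2"
    using assms by (intro power_mono) auto
  ultimately show ?thesis by (simp add: mult_left_mono)
qed

theorem theorem1p3:
  fixes f :: "real^'n \<Rightarrow> complex" and \<alpha> \<beta> :: real
  assumes "CARD('n) \<ge> 2"
    and "\<alpha> < \<beta>" and "1/2 < \<beta>" and "\<beta> \<le> 1"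
    and "f \<in> Q_space \<alpha> \<beta>"
    and "Q_norm \<alpha> \<beta> f \<noteq> 0"
  shows "\<exists>B b :: real. B > 0 \<and> b > 0 \<and>
    (\<forall>(t::real) (a::real^'n) (l::real).
       0 < l \<and>
       ((0 < t \<and> t \<le> Q_norm \<alpha> \<beta> f) \<or> (t > Q_norm \<alpha> \<beta> f \<and> l powr (2 * \<beta> - 2) \<ge> 1)) \<longrightarrow>
       dyadic_dist_sum \<alpha> \<beta> f a l t
         \<le> ennreal (B * max 1 ((Q_norm \<alpha> \<beta> f / t)\<^sup>2) * exp (- b * t / Q_norm \<alpha> \<beta> f))) \<and>
    (\<forall>(t::real) (a::real^'n) (l::real).
       0 < l \<and> t > Q_norm \<alpha> \<beta> f \<and> l powr (2 * \<beta> - 2) < 1 \<longrightarrow>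
       dyadic_dist_sum \<alpha> \<beta> f a l t \<le> ennreal B)"
proof -
  note f = assms(5)
  define N where "N = Q_norm \<alpha> \<beta> f"
  have N: "0 < N" using assms(6) by (simp add: N_def Q_norm_def less_le)
  define C where "C = osc_const TYPE('n) (real CARD('n) + 2 * (\<alpha> - \<beta> + 1))"
  have C: "0 < C" unfolding C_def by (rule osc_const_pos)
  \<comment> \<open>The scaling constant of \<open>dyadic_tail\<close> for norm 1; in general it is
    \<open>c0 / N\<close>.\<close>
  define c0 where "c0 = 1 / (4 * sqrt (C * 2 ^ CARD('n)))"
  have c0: "0 < c0" using C by (simp add: c0_def)
  \<comment> \<open>The factor \<open>1/4\<close> comes from the two halvings of the
    threshold.\<close>
  define b where "b = c0 / 4"
  have b: "0 < b" using c0 by (simp add: b_def)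
  define d where "d = (1 - exp (- b))\<^sup>2"
  have d: "0 < d" using b by (simp add: d_def)
  \<comment> \<open>For \<open>t \<le> N\<close> the exponential in the claim is at least
    \<open>exp (- b)\<close>; the factor \<open>exp b\<close> pays for it.\<close>
  define B1 where "B1 = 8 * C * exp b"
  define B2 where "B2 = 16 * c0\<^sup>2 * C / d"
  define B where "B = B1 + B2"
  have B1: "0 < B1" using C by (simp add: B1_def)
  have B2: "0 < B2" using C c0 d by (simp add: B2_def)
  \<comment> \<open>Chebyshev at level \<open>t / 2\<close>, that is
    \<open>\<kappa> = 4 / t\<^sup>2\<close>.\<close>
  have cheb: "dyadic_dist_sum \<alpha> \<beta> f a l t \<le> ennreal (8 * C * (N / t)\<^sup>2)" if l: "0 < l" and t: "0 < t" for a l t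
  proof -
    have "dyadic_dist_sum \<alpha> \<beta> f a l t \<le> ennreal (2 * (4 / t\<^sup>2) * (C * N\<^sup>2))"
      unfolding C_def N_def
    proof (rule dyadic_dist_sum_le[OF f l])
      fix g :: "real^'n \<Rightarrow> real" and k :: nat and p :: "'n \<Rightarrow> nat"
      assume g: "g \<in> parts f"
      let ?h = "l / 2 ^ k" and ?J = "hcube (corner a l k p) (l / 2 ^ k)"
      have h: "0 < ?h" using l by simp
      note g1 = parts_Q_space(1)[OF f h g] and g' = parts_Q_space(2-5)[OF f h g, of "corner a l k p"]
      have "measure lebesgue {x\<in>?J. t / 2 < \<bar>g x - mean g ?J\<bar>} \<le> measure lebesgue {x\<in>?J. t / 2 \<le> \<bar>g x - mean g ?J\<bar>}"
      proof (rule measure_mono_fmeasurable)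
        have [measurable]: "g \<in> borel_measurable lebesgue" by (rule g1)
        have "{x\<in>?J. t / 2 < \<bar>g x - mean g ?J\<bar>} = ?J \<inter> {x\<in>space lebesgue. t / 2 < \<bar>g x - mean g ?J\<bar>}" by auto
        also have "\<dots> \<in> sets lebesgue" by measurable
        finally show "{x\<in>?J. t / 2 < \<bar>g x - mean g ?J\<bar>} \<in> sets lebesgue" .
        have "{x\<in>?J. t / 2 \<le> \<bar>g x - mean g ?J\<bar>} = ?J \<inter> {x\<in>space lebesgue. t / 2 \<le> \<bar>g x - mean g ?J\<bar>}" by auto
        also have "\<dots> \<in> sets lebesgue" by measurable
        finally show "{x\<in>?J. t / 2 \<le> \<bar>g x - mean g ?J\<bar>} \<in> fmeasurable lebesgue"
          using le_less_trans[OF emeasure_mono[of "{x\<in>?J. t / 2 \<le> \<bar>g x - mean g ?J\<bar>}" ?J lebesgue] emeasure_hcube_finite[OF h]]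
          by (intro fmeasurableI) auto
      qed auto
      also have "\<dots> \<le> measure lebesgue ?J * var g ?J / (t / 2)\<^sup>2"
        by (rule chebyshev_mean[OF g'(1,2) hcube_lebesgue emeasure_hcube_finite[OF h]]) (use t in simp)
      also have "\<dots> = ?h ^ CARD('n) * (4 / t\<^sup>2 * var g ?J)"
        using h t by (simp add: measure_hcube power_divide)
      finally show "measure lebesgue {x\<in>?J. t / 2 < \<bar>g x - mean g ?J\<bar>} \<le> ?h ^ CARD('n) * (4 / t\<^sup>2 * var g ?J)" .
    qed simp
    also have "2 * (4 / t\<^sup>2) * (C * N\<^sup>2) = 8 * C * (N / t)\<^sup>2" by (simp add: power_divide)
    finally show ?thesis .
  qed
  \<comment> \<open>John-Nirenberg at level \<open>t / 2\<close>, that is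
    \<open>\<kappa> = 8 * c\<^sup>2 / D\<close>. The condition \<open>N < t\<close> keeps the
    exponent \<open>b * t / N\<close> above \<open>b\<close>, as \<open>exp_sum_minus_2_ge\<close>
    requires.\<close>
  have tail: "dyadic_dist_sum \<alpha> \<beta> f a l t \<le> ennreal (B2 * exp (- b * t / N))"
    if l: "0 < l" "1 \<le> l powr (2 * \<beta> - 2)" and t: "N < t" for a l t
  proof -
    define c where "c = 1 / (4 * sqrt (C * N\<^sup>2 * 2 ^ CARD('n)))"
    have c: "c = c0 / N" using N by (simp add: c_def c0_def real_sqrt_mult)
    define D where "D = exp (c * (t / 2) / 2) + exp (- (c * (t / 2) / 2)) - 2"
    have z: "c * (t / 2) / 2 = b * t / N" by (simp add: c b_def)
    have "b \<le> b * t / N" using b N t by (simp add: field_simps)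
    then have D: "exp (b * t / N) * d \<le> D"
      unfolding D_def z d_def by (rule exp_sum_minus_2_ge[OF b])
    have Dpos: "0 < D" using D d by (meson exp_gt_zero less_le_trans mult_pos_pos)
    have "dyadic_dist_sum \<alpha> \<beta> f a l t \<le> ennreal (2 * (8 * c\<^sup>2 / D) * (C * N\<^sup>2))"
      unfolding C_def N_def
    proof (rule dyadic_dist_sum_le[OF f l(1)])
      fix g :: "real^'n \<Rightarrow> real" and k :: nat and p :: "'n \<Rightarrow> nat"
      assume g: "g \<in> parts f"
      let ?h = "l / 2 ^ k" and ?J = "hcube (corner a l k p) (l / 2 ^ k)"
      have h: "0 < ?h" "?h \<le> l" using l by (auto simp: divide_le_eq mult_le_cancel_left1)
      note g1 = parts_Q_space(1)[OF f h(1) g] and g' = parts_Q_space(2-5)[OF f h(1) g, of "corner a l k p"]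
      \<comment> \<open>\<open>dyadic_tail\<close> is applied on every cube of the sum, so the
        variance bound must reach the subcubes of subcubes.\<close>
      have var: "var g (hcube (corner (corner a l k p) ?h i q) (?h / 2 ^ i)) \<le> C * N\<^sup>2" for i q
      proof -
        let ?r = "?h / 2 ^ i" and ?K = "hcube (corner (corner a l k p) ?h i q) (?h / 2 ^ i)"
        have r: "0 < ?r" using h by simp
        have "x / 2 ^ j \<le> x" if "0 < x" for x :: real and j :: nat
          using that by (simp add: divide_le_eq mult_le_cancel_left1)
        from this[OF h(1), of i] have rl: "?r \<le> l" using h(2) by linarith
        have "1 \<le> (l powr (2 * \<beta> - 2))\<^sup>2" using l(2) by (simp add: one_le_power)
        also have "\<dots> = l powr (4 * \<beta> - 4)" using l(1) by (simp add: powr_realpow[symmetric] powr_powr)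
        also have "\<dots> \<le> ?r powr (4 * \<beta> - 4)" using assms(4) r rl by (intro powr_mono2') auto
        finally have one: "1 \<le> ?r powr (4 * \<beta> - 4)" .
        have "ennreal (var g ?K) \<le> double_osc f ?K 0 / ennreal ((?r ^ CARD('n))\<^sup>2)"
          by (rule parts_Q_space(4)[OF f r g])
        also have "\<dots> \<le> ennreal (?r powr (4 * \<beta> - 4)) * (double_osc f ?K 0 / ennreal ((?r ^ CARD('n))\<^sup>2))"
          using mult_right_mono[of 1 "ennreal (?r powr (4 * \<beta> - 4))" "double_osc f ?K 0 / ennreal ((?r ^ CARD('n))\<^sup>2)"] one
          by simp
        also have "\<dots> \<le> ennreal (C * N\<^sup>2)" unfolding C_def N_def by (rule Q_norm_osc_cube[OF f r])
        finally show ?thesis using C by (subst (asm) ennreal_le_iff) auto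
      qed
      have "measure lebesgue {x\<in>?J. t / 2 < \<bar>g x - mean g ?J\<bar>} * D \<le> ?h ^ CARD('n) * (8 * c\<^sup>2 * var g ?J)"
        unfolding D_def c_def by (rule dyadic_tail[OF g1 g'(1,2) h(1)]) (use C N t var in auto)
      then have "measure lebesgue {x\<in>?J. t / 2 < \<bar>g x - mean g ?J\<bar>} \<le> ?h ^ CARD('n) * (8 * c\<^sup>2 * var g ?J) / D"
        unfolding pos_le_divide_eq[OF Dpos] .
      then show "measure lebesgue {x\<in>?J. t / 2 < \<bar>g x - mean g ?J\<bar>} \<le> ?h ^ CARD('n) * (8 * c\<^sup>2 / D * var g ?J)"
        by simp
    qed (use Dpos in simp)
    also have "2 * (8 * c\<^sup>2 / D) * (C * N\<^sup>2) \<le> B2 * exp (- b * t / N)"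
    proof -
      \<comment> \<open>\<open>N\<close> cancels because \<open>c = c0 / N\<close>, so
        \<open>B2\<close> does not depend on the norm.\<close>
      have "2 * (8 * c\<^sup>2 / D) * (C * N\<^sup>2) = 16 * c0\<^sup>2 * C / D" using N by (simp add: c power_divide)
      also have "\<dots> \<le> 16 * c0\<^sup>2 * C / (exp (b * t / N) * d)"
        using C D d by (intro divide_left_mono) (auto intro!: mult_pos_pos Dpos)
      also have "\<dots> = B2 * exp (- b * t / N)" by (simp add: B2_def exp_minus field_simps)
      finally show ?thesis .
    qed
    then have "ennreal (2 * (8 * c\<^sup>2 / D) * (C * N\<^sup>2)) \<le> ennreal (B2 * exp (- b * t / N))" by (rule ennreal_leI)
    finally show ?thesis .
  qed
  have decay: "dyadic_dist_sum \<alpha> \<beta> f a l t \<le> ennreal (B * max 1 ((N / t)\<^sup>2) * exp (- b * t / N))"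
    if l: "0 < l" and t: "(0 < t \<and> t \<le> N) \<or> (t > N \<and> l powr (2 * \<beta> - 2) \<ge> 1)" for t a l
    using t
  proof
    assume t: "0 < t \<and> t \<le> N"
    have "b * t / N \<le> b" using b N t by (simp add: field_simps)
    then have "1 \<le> exp b * exp (- b * t / N)" by (simp add: exp_add[symmetric])
    then have "8 * C * (N / t)\<^sup>2 * 1 \<le> 8 * C * (N / t)\<^sup>2 * (exp b * exp (- b * t / N))"
      using C by (intro mult_left_mono) auto
    also have "\<dots> = B1 * (N / t)\<^sup>2 * exp (- b * t / N)" by (simp add: B1_def)
    also have "\<dots> \<le> B * max 1 ((N / t)\<^sup>2) * exp (- b * t / N)"
      using B1 B2 by (intro mult_right_mono mult_mono) (auto simp: B_def)
    finally show ?thesis using t by (intro order_trans[OF cheb[OF l, of t a]] ennreal_leI) auto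
  next
    assume t: "t > N \<and> l powr (2 * \<beta> - 2) \<ge> 1"
    have "B2 * exp (- b * t / N) = B2 * 1 * exp (- b * t / N)" by simp
    also have "\<dots> \<le> B * max 1 ((N / t)\<^sup>2) * exp (- b * t / N)"
      using B1 B2 by (intro mult_right_mono mult_mono) (auto simp: B_def)
    finally show ?thesis using t by (intro order_trans[OF tail[OF l, of t a]] ennreal_leI) auto
  qed
  have bounded: "dyadic_dist_sum \<alpha> \<beta> f a l t \<le> ennreal B" if l: "0 < l" and t: "t > N" for t a l
  proof -
    have "(N / t)\<^sup>2 \<le> 1" using N t by (intro power_le_one) auto
    then have "8 * C * (N / t)\<^sup>2 \<le> 8 * C * 1" using C by (intro mult_left_mono) auto
    also have "\<dots> \<le> B1" using C b unfolding B1_def by (intro mult_left_mono) auto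
    also have "\<dots> \<le> B" using B2 by (simp add: B_def)
    finally show ?thesis using t N by (intro order_trans[OF cheb[OF l, of t a]] ennreal_leI) auto
  qed
  have "0 < B" using B1 B2 by (simp add: B_def)
  then show ?thesis
    unfolding N_def[symmetric] using b decay bounded by (intro exI[of _ B] exI[of _ b]) simp
qed

end
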